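(* Let $G:I\to I$ be the Gauss map. For $\alpha\in(0,1]$, there is an open subset $U$ of $C^{0,\alpha}(I)$ consisting of functions with the periodic optimization property (with respect to $G$), such that $U$ is a dense subset of $\mathfrak{E}^\alpha(G)$.
   Context: $I=[0,1]$; the Gauss map $G:I\to I$ is $G(x)=\frac1x-\lfloor\frac1x\rfloor$ for $x\in(0,1]$ and $G(0)=0$. $C^{0,\alpha}(I)$ is the Banach space of real-valued $\alpha$-Hölder functions with norm $\|\psi\|_\infty+\sup_{x\ne y}|\psi(x)-\psi(y)|/|x-y|^\alpha$. $\mathcal{M}(I,G)$ is the set of $G$-invariant Borel probability measures on $I$. A measure $\mu\in\mathcal{M}(I,G)$ is $(G,\phi)$-maximizing if $\int\phi\,d\mu=Q(G,\phi):=\sup_{\nu\in\mathcal{M}(I,G)}\int\phi\,d\nu$. A function $\phi\in C^{0,\alpha}(I)$ has the periodic optimization property if there exists a $G$-periodic orbit $\mathcal{O}$ such that the probability measure uniformly distributed on $\mathcal{O}$ is the unique $(G,\phi)$-maximizing measure. $\mathfrak{E}^\alpha(G)$ (essentially compact functions) is the set of $\phi\in C^{0,\alpha}(I)$ that have a $(G,\phi)$-maximizing measure whose support does not contain the point $0$. *)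

theory Defs
  imports "HOL-Probability.Probability"
begin

definition gauss_map :: "real \<Rightarrow> real" where
  "gauss_map x = (if x = 0 then 0 else 1 / x - of_int \<lfloor>1 / x\<rfloor>)"

text \<open>Functions on the unit interval are represented by the extensional functions, so that
  each function on the interval has exactly one representative.\<close>

definition holder_space :: "real \<Rightarrow> (real \<Rightarrow> real) set" where
  "holder_space \<alpha> = {\<psi> \<in> extensional {0..1}.
     \<exists>C. \<forall>x\<in>{0..1}. \<forall>y\<in>{0..1}. \<bar>\<psi> x - \<psi> y\<bar> \<le> C * \<bar>x - y\<bar> powr \<alpha>}"

definition holder_norm :: "real \<Rightarrow> (real \<Rightarrow> real) \<Rightarrow> real" where
  "holder_norm \<alpha> \<psi> = (SUP x\<in>{0..1}. \<bar>\<psi> x\<bar>)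
     + (SUP (x, y)\<in>{(x, y). x \<in> {0..1} \<and> y \<in> {0..1} \<and> x \<noteq> y}.
          \<bar>\<psi> x - \<psi> y\<bar> / \<bar>x - y\<bar> powr \<alpha>)"

text \<open>The case distinction only serves the locale \<^locale>\<open>Metric_space\<close>, which requires distances to be
  nonnegative outside the carrier too.\<close>

definition holder_dist :: "real \<Rightarrow> (real \<Rightarrow> real) \<Rightarrow> (real \<Rightarrow> real) \<Rightarrow> real" where
  "holder_dist \<alpha> \<phi> \<psi> =
     (if \<phi> \<in> holder_space \<alpha> \<and> \<psi> \<in> holder_space \<alpha> then holder_norm \<alpha> (\<lambda>x. \<phi> x - \<psi> x) else 0)"

definition holder_topology :: "real \<Rightarrow> (real \<Rightarrow> real) topology" where
  "holder_topology \<alpha> = Metric_space.mtopology (holder_space \<alpha>) (holder_dist \<alpha>)"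

abbreviation unit_borel :: "real measure" where
  "unit_borel \<equiv> restrict_space borel {0..1}"

definition invariant_measures :: "real measure set" where
  "invariant_measures = {\<mu>. prob_space \<mu> \<and> sets \<mu> = sets unit_borel \<and> distr \<mu> \<mu> gauss_map = \<mu>}"

definition max_integral :: "(real \<Rightarrow> real) \<Rightarrow> real" where
  "max_integral \<phi> = (SUP \<nu>\<in>invariant_measures. \<integral>x. \<phi> x \<partial>\<nu>)"

definition maximizing :: "(real \<Rightarrow> real) \<Rightarrow> real measure \<Rightarrow> bool" where
  "maximizing \<phi> \<mu> \<longleftrightarrow> \<mu> \<in> invariant_measures \<and> (\<integral>x. \<phi> x \<partial>\<mu>) = max_integral \<phi>"

definition periodic_orbit :: "real set \<Rightarrow> bool" where
  "periodic_orbit S \<longleftrightarrow> (\<exists>x\<in>{0..1}. \<exists>p>0. (gauss_map ^^ p) x = x \<and>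
     S = (\<lambda>k. (gauss_map ^^ k) x) ` {..<p})"

definition orbit_measure :: "real set \<Rightarrow> real measure" where
  "orbit_measure S = distr (uniform_count_measure S) unit_borel (\<lambda>x. x)"

definition periodic_optimization :: "(real \<Rightarrow> real) \<Rightarrow> bool" where
  "periodic_optimization \<phi> \<longleftrightarrow>
     (\<exists>S. periodic_orbit S \<and> (\<forall>\<mu>. maximizing \<phi> \<mu> \<longleftrightarrow> \<mu> = orbit_measure S))"

definition measure_support :: "real measure \<Rightarrow> real set" where
  "measure_support \<mu> = {x \<in> space \<mu>. \<forall>V. open V \<and> x \<in> V \<longrightarrow> emeasure \<mu> (V \<inter> space \<mu>) > 0}"

definition essentially_compact :: "real \<Rightarrow> (real \<Rightarrow> real) set" where
  "essentially_compact \<alpha> =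
     {\<phi> \<in> holder_space \<alpha>. \<exists>\<mu>. maximizing \<phi> \<mu> \<and> 0 \<notin> measure_support \<mu>}"

lemma gauss_map_measurable: "gauss_map \<in> measurable unit_borel unit_borel"
proof (rule measurable_restrict_space3)
  show "gauss_map \<in> borel_measurable borel"
    unfolding gauss_map_def by measurable
  show "gauss_map \<in> {0..1} \<rightarrow> {0..1}"
    by (auto simp: gauss_map_def) linarith+
qed

lemma holder_bounds:
  assumes "0 < \<alpha>"
    and C: "\<And>x y. x \<in> {0..1} \<Longrightarrow> y \<in> {0..1} \<Longrightarrow> \<bar>\<psi> x - \<psi> y\<bar> \<le> C * \<bar>x - y\<bar> powr \<alpha>"
  shows "bdd_above ((\<lambda>x. \<bar>\<psi> x\<bar>) ` {0..1::real})"
    and "bdd_above ((\<lambda>(x, y). \<bar>\<psi> x - \<psi> y\<bar> / \<bar>x - y\<bar> powr \<alpha>) `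
      {(x, y). x \<in> {0..1} \<and> y \<in> {0..1} \<and> x \<noteq> y})"
proof -
  have "\<bar>\<psi> x\<bar> \<le> \<bar>\<psi> 0\<bar> + \<bar>C\<bar>" if "x \<in> {0..1}" for x
  proof -
    have "\<bar>x\<bar> powr \<alpha> \<le> 1" using that assms(1) by (auto intro!: powr_le1)
    then have "C * \<bar>x\<bar> powr \<alpha> \<le> \<bar>C\<bar> * 1"
      by (intro mult_mono) auto
    then show ?thesis using C[OF that, of 0] by simp
  qed
  then show "bdd_above ((\<lambda>x. \<bar>\<psi> x\<bar>) ` {0..1::real})"
    by (intro bdd_aboveI2[where M="\<bar>\<psi> 0\<bar> + \<bar>C\<bar>"])
  show "bdd_above ((\<lambda>(x, y). \<bar>\<psi> x - \<psi> y\<bar> / \<bar>x - y\<bar> powr \<alpha>) `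
      {(x, y). x \<in> {0..1} \<and> y \<in> {0..1} \<and> x \<noteq> y})"
    using C by (intro bdd_aboveI2[where M=C]) (auto simp: divide_le_eq)
qed

lemma holder_space_diff:
  assumes "\<phi> \<in> holder_space \<alpha>" "\<psi> \<in> holder_space \<alpha>"
  obtains C where "\<And>x y. x \<in> {0..1} \<Longrightarrow> y \<in> {0..1} \<Longrightarrow>
    \<bar>(\<phi> x - \<psi> x) - (\<phi> y - \<psi> y)\<bar> \<le> C * \<bar>x - y\<bar> powr \<alpha>"
proof -
  obtain A where A: "\<forall>x\<in>{0..1}. \<forall>y\<in>{0..1}. \<bar>\<phi> x - \<phi> y\<bar> \<le> A * \<bar>x - y\<bar> powr \<alpha>"
    using assms(1) unfolding holder_space_def by blast
  obtain B where B: "\<forall>x\<in>{0..1}. \<forall>y\<in>{0..1}. \<bar>\<psi> x - \<psi> y\<bar> \<le> B * \<bar>x - y\<bar> powr \<alpha>"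
    using assms(2) unfolding holder_space_def by blast
  have "\<bar>(\<phi> x - \<psi> x) - (\<phi> y - \<psi> y)\<bar> \<le> (A + B) * \<bar>x - y\<bar> powr \<alpha>"
    if "x \<in> {0..1}" "y \<in> {0..1}" for x y
  proof -
    have "\<bar>\<phi> x - \<phi> y\<bar> \<le> A * \<bar>x - y\<bar> powr \<alpha>" "\<bar>\<psi> x - \<psi> y\<bar> \<le> B * \<bar>x - y\<bar> powr \<alpha>"
      using A B that by blast+
    then show ?thesis unfolding distrib_right by linarith
  qed
  then show thesis by (rule that)
qed

lemma holder_norm_upper:
  assumes "bdd_above ((\<lambda>x. \<bar>\<psi> x\<bar>) ` {0..1::real})"
    and "bdd_above ((\<lambda>(x, y). \<bar>\<psi> x - \<psi> y\<bar> / \<bar>x - y\<bar> powr \<alpha>) `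
      {(x, y). x \<in> {0..1} \<and> y \<in> {0..1} \<and> x \<noteq> y})"
    and "z \<in> {0..1}"
  shows "\<bar>\<psi> z\<bar> \<le> holder_norm \<alpha> \<psi>"
proof -
  have "\<bar>\<psi> z\<bar> \<le> (SUP x\<in>{0..1}. \<bar>\<psi> x\<bar>)"
    by (rule cSUP_upper[OF assms(3,1)])
  moreover have "\<bar>\<psi> 0 - \<psi> 1\<bar> / \<bar>0 - 1\<bar> powr \<alpha> \<le>
      (SUP (x, y)\<in>{(x, y). x \<in> {0..1} \<and> y \<in> {0..1} \<and> x \<noteq> y}.
          \<bar>\<psi> x - \<psi> y\<bar> / \<bar>x - y\<bar> powr \<alpha>)"
    using cSUP_upper[OF _ assms(2), of "(0, 1)"] by simp
  ultimately show ?thesis unfolding holder_norm_def by simp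
qed

lemma holder_norm_triangle:
  assumes f: "bdd_above ((\<lambda>x. \<bar>f x\<bar>) ` {0..1::real})"
    "bdd_above ((\<lambda>(x, y). \<bar>f x - f y\<bar> / \<bar>x - y\<bar> powr \<alpha>) `
      {(x, y). x \<in> {0..1} \<and> y \<in> {0..1} \<and> x \<noteq> y})"
    and g: "bdd_above ((\<lambda>x. \<bar>g x\<bar>) ` {0..1::real})"
    "bdd_above ((\<lambda>(x, y). \<bar>g x - g y\<bar> / \<bar>x - y\<bar> powr \<alpha>) `
      {(x, y). x \<in> {0..1} \<and> y \<in> {0..1} \<and> x \<noteq> y})"
  shows "holder_norm \<alpha> (\<lambda>x. f x + g x) \<le> holder_norm \<alpha> f + holder_norm \<alpha> g"
proof -
  let ?D = "{(x, y). x \<in> {0..1::real} \<and> y \<in> {0..1} \<and> x \<noteq> y}"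
  let ?q = "\<lambda>f (x, y). \<bar>f x - f y\<bar> / \<bar>x - y\<bar> powr \<alpha>"
  have "(SUP x\<in>{0..1}. \<bar>f x + g x\<bar>) \<le> (SUP x\<in>{0..1}. \<bar>f x\<bar>) + (SUP x\<in>{0..1}. \<bar>g x\<bar>)"
  proof (rule cSUP_least)
    fix x :: real assume "x \<in> {0..1}"
    then show "\<bar>f x + g x\<bar> \<le> (SUP x\<in>{0..1}. \<bar>f x\<bar>) + (SUP x\<in>{0..1}. \<bar>g x\<bar>)"
      using cSUP_upper[OF _ f(1), of x] cSUP_upper[OF _ g(1), of x] by linarith
  qed simp
  moreover have "(SUP p\<in>?D. ?q (\<lambda>x. f x + g x) p) \<le> (SUP p\<in>?D. ?q f p) + (SUP p\<in>?D. ?q g p)"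
  proof (rule cSUP_least)
    have "(0, 1) \<in> ?D" by simp
    then show "?D \<noteq> {}" by blast
  next
    fix p assume p: "p \<in> ?D"
    have "?q (\<lambda>x. f x + g x) p \<le> ?q f p + ?q g p"
      by (cases p) (auto simp: add_divide_distrib[symmetric] intro!: divide_right_mono)
    then show "?q (\<lambda>x. f x + g x) p \<le> (SUP p\<in>?D. ?q f p) + (SUP p\<in>?D. ?q g p)"
      using cSUP_upper[OF p f(2)] cSUP_upper[OF p g(2)] by linarith
  qed
  ultimately show ?thesis unfolding holder_norm_def by linarith
qed

lemma Metric_space_holder:
  assumes "0 < \<alpha>"
  shows "Metric_space (holder_space \<alpha>) (holder_dist \<alpha>)"
proof
  have bdd: "bdd_above ((\<lambda>x. \<bar>\<phi> x - \<psi> x\<bar>) ` {0..1::real})"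
    "bdd_above ((\<lambda>(x, y). \<bar>(\<phi> x - \<psi> x) - (\<phi> y - \<psi> y)\<bar> / \<bar>x - y\<bar> powr \<alpha>) `
      {(x, y). x \<in> {0..1} \<and> y \<in> {0..1} \<and> x \<noteq> y})"
    if h: "\<phi> \<in> holder_space \<alpha>" "\<psi> \<in> holder_space \<alpha>" for \<phi> \<psi>
  proof -
    obtain C where C: "\<And>x y. x \<in> {0..1} \<Longrightarrow> y \<in> {0..1} \<Longrightarrow>
        \<bar>(\<phi> x - \<psi> x) - (\<phi> y - \<psi> y)\<bar> \<le> C * \<bar>x - y\<bar> powr \<alpha>"
      using holder_space_diff[OF h] by blast
    show "bdd_above ((\<lambda>x. \<bar>\<phi> x - \<psi> x\<bar>) ` {0..1::real})"
      "bdd_above ((\<lambda>(x, y). \<bar>(\<phi> x - \<psi> x) - (\<phi> y - \<psi> y)\<bar> / \<bar>x - y\<bar> powr \<alpha>) `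
      {(x, y). x \<in> {0..1} \<and> y \<in> {0..1} \<and> x \<noteq> y})"
      by (rule holder_bounds[of \<alpha> "\<lambda>x. \<phi> x - \<psi> x" C]; use assms C in simp)+
  qed
  have upper: "\<bar>\<phi> z - \<psi> z\<bar> \<le> holder_dist \<alpha> \<phi> \<psi>"
    if "\<phi> \<in> holder_space \<alpha>" "\<psi> \<in> holder_space \<alpha>" "z \<in> {0..1}" for \<phi> \<psi> z
    using holder_norm_upper[of "\<lambda>x. \<phi> x - \<psi> x", OF bdd[OF that(1,2)] that(3)] that
    by (simp add: holder_dist_def)
  have self: "holder_dist \<alpha> \<phi> \<phi> = 0" for \<phi>
  proof -
    have "(0, 1) \<in> {(x, y). x \<in> {0..1::real} \<and> y \<in> {0..1::real} \<and> x \<noteq> y}" by simp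
    then have "{(x, y). x \<in> {0..1::real} \<and> y \<in> {0..1::real} \<and> x \<noteq> y} \<noteq> {}" by blast
    then show ?thesis by (simp add: holder_dist_def holder_norm_def case_prod_beta)
  qed
  show "holder_dist \<alpha> \<phi> \<psi> = holder_dist \<alpha> \<psi> \<phi>" for \<phi> \<psi>
  proof -
    have "\<bar>\<phi> x - \<psi> x - (\<phi> y - \<psi> y)\<bar> = \<bar>\<psi> x - \<phi> x - (\<psi> y - \<phi> y)\<bar>" for x y
      by linarith
    then show ?thesis unfolding holder_dist_def holder_norm_def
      by (simp add: abs_minus_commute conj_commute)
  qed
  show "0 \<le> holder_dist \<alpha> \<phi> \<psi>" for \<phi> \<psi>
  proof (cases "\<phi> \<in> holder_space \<alpha> \<and> \<psi> \<in> holder_space \<alpha>")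
    case True
    then have "\<bar>\<phi> 0 - \<psi> 0\<bar> \<le> holder_dist \<alpha> \<phi> \<psi>" by (intro upper) auto
    then show ?thesis by linarith
  next
    case False
    then show ?thesis by (auto simp: holder_dist_def)
  qed
  show "holder_dist \<alpha> \<phi> \<psi> = 0 \<longleftrightarrow> \<phi> = \<psi>"
    if "\<phi> \<in> holder_space \<alpha>" "\<psi> \<in> holder_space \<alpha>" for \<phi> \<psi>
  proof
    assume "holder_dist \<alpha> \<phi> \<psi> = 0"
    then have "\<phi> z = \<psi> z" if "z \<in> {0..1}" for z
      using upper[OF \<open>\<phi> \<in> _\<close> \<open>\<psi> \<in> _\<close> that] by simp
    then show "\<phi> = \<psi>"
      using that by (auto simp: holder_space_def intro: extensionalityI)
  qed (simp add: self)
  show "holder_dist \<alpha> f h \<le> holder_dist \<alpha> f g + holder_dist \<alpha> g h"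
    if "f \<in> holder_space \<alpha>" "g \<in> holder_space \<alpha>" "h \<in> holder_space \<alpha>" for f g h
    using holder_norm_triangle[of "\<lambda>x. f x - g x" \<alpha> "\<lambda>x. g x - h x",
        OF bdd[OF that(1,2)] bdd[OF that(2,3)]]
    using that by (simp add: holder_dist_def)
qed

end

theory Submission
  imports Defs "HOL-Real_Asymp.Real_Asymp"
begin

text \<open>
  The inverse branches \<open>x \<mapsto> 1 / (k + x)\<close> contract uniformly, so every Hoelder function \<open>\<phi>\<close> has a
  Hoelder sub-action \<open>u\<close> with \<open>\<phi> \<le> Q + u \<circ> G - u\<close>, and maximality of an orbit need only be tested against
  periodic orbits. If a maximizing measure is supported away from 0, some orbit with bounded digits
  stays in the contact set, where equality holds. Call the sum of the defects of this inequality along a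
  periodic orbit its cost. The Bressaud-Quas counting argument yields periodic orbits shadowing the contact
  orbit whose cost is smaller than any power of the inverse period, and repeatedly splitting such an orbit
  at its closest pair of points yields a periodic orbit \<open>S\<close> whose cost is small compared with the power \<open>\<alpha>\<close> of
  its minimal gap. Subtracting a small multiple of \<open>dist(\<cdot>, S)^\<alpha>\<close> from \<open>\<phi>\<close> then makes \<open>S\<close> the unique
  maximizing orbit, robustly under perturbations that are small in the Hoelder norm.
\<close>

section \<open>Inverse branches and continued fractions\<close>

text \<open>The Gauss map is discontinuous and has infinitely many branches, so the arguments run on
  digit sequences and inverse branches, which are defined on all of [0,1]. Two defects need repair.
  The branch of digit 1 has derivative -1 at 0, so contraction is measured in another metric. The
  point mass at 0 is invariant, yet 0 lies in the image of no branch; its value is reached as a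
  limit of values at fixed points with large digits. Essential compactness enters through the finite
  alphabet of the contact orbit: it makes the factor counts finite and bounds the expansion of the
  Gauss map near the orbits used. Closing and splitting never introduce new digits, so the digit
  bound, and with it the required ratio between cost and gap, is fixed before the orbit is chosen.
  Each splitting may then multiply the cost by a large constant, and the number of splittings can
  grow like the logarithm of the period. The accumulated loss is a power of the period whose
  exponent is not under control, which is why the initial cost has to beat every such power.\<close>

definition branch :: "nat \<Rightarrow> real \<Rightarrow> real" where
  "branch k x = 1 / (real k + x)"

text \<open>The Euclidean distance pulled back by the chart x -> 1 / (1 + x). It is equivalent to
  the usual one on the unit interval, and every branch contracts it uniformly, the branch of digit 1
  included.\<close>

definition cdist :: "real \<Rightarrow> real \<Rightarrow> real" where
  "cdist x y = \<bar>1 / (1 + x) - 1 / (1 + y)\<bar>"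

text \<open>A finite backward orbit, indexed in forward time: \<open>y n\<close> is free and
  determines the rest. Steps are expressed by \<open>branch\<close> and not by
  \<open>gauss_map\<close>, because an endpoint \<open>y n = 1\<close> is allowed and the Gauss map
  sends \<open>branch k 1\<close> to 0.\<close>

definition chain :: "(nat \<Rightarrow> nat) \<Rightarrow> (nat \<Rightarrow> real) \<Rightarrow> nat \<Rightarrow> bool" where
  "chain a y n \<longleftrightarrow> (\<forall>i<n. 1 \<le> a i \<and> y i = branch (a i) (y (Suc i))) \<and> (\<forall>i\<le>n. y i \<in> {0..1})"

lemma branch_unit:
  assumes "1 \<le> k" "x \<in> {0..1}"
  shows "branch k x \<in> {0<..1}"
  using assms by (auto simp: branch_def)

lemma branch_unit': "1 \<le> k \<Longrightarrow> x \<in> {0..1} \<Longrightarrow> branch k x \<in> {0..1}"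
  using branch_unit[of k x] by auto

lemma cdist_eq:
  assumes "x \<in> {0..1}" "y \<in> {0..1}"
  shows "cdist x y = \<bar>x - y\<bar> / ((1 + x) * (1 + y))"
proof -
  have "1 / (1 + x) - 1 / (1 + y) = (y - x) / ((1 + x) * (1 + y))"
    using assms by (simp add: field_simps)
  then show ?thesis
    using assms unfolding cdist_def by (simp add: abs_mult abs_minus_commute)
qed

lemma cdist_le:
  assumes "x \<in> {0..1}" "y \<in> {0..1}"
  shows "cdist x y \<le> \<bar>x - y\<bar>"
proof -
  have "1 * 1 \<le> (1 + x) * (1 + y)"
    using assms by (intro mult_mono) auto
  then show ?thesis
    using assms by (simp add: cdist_eq divide_le_eq mult_left_le_one_le mult_le_cancel_left1)
qed

lemma cdist_ge:
  assumes "x \<in> {0..1}" "y \<in> {0..1}"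
  shows "\<bar>x - y\<bar> \<le> 4 * cdist x y"
proof -
  have "(1 + x) * (1 + y) \<le> 2 * 2"
    using assms by (intro mult_mono) auto
  then have "\<bar>x - y\<bar> * ((1 + x) * (1 + y)) \<le> \<bar>x - y\<bar> * 4"
    by (intro mult_left_mono) auto
  moreover have "0 < (1 + x) * (1 + y)" using assms by (intro mult_pos_pos) auto
  ultimately show ?thesis
    using assms by (simp add: cdist_eq pos_le_divide_eq)
qed

lemma cdist_triangle: "cdist x z \<le> cdist x y + cdist y z"
  unfolding cdist_def by linarith

lemma cdist_nonneg: "0 \<le> cdist x y"
  unfolding cdist_def by simp

lemma cdist_branch:
  assumes "1 \<le> k" "x \<in> {0..1}" "y \<in> {0..1}"
  shows "cdist (branch k x) (branch k y) \<le> cdist x y / 2"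
proof -
  have e: "cdist (branch k x) (branch k y) = \<bar>x - y\<bar> / ((real k + 1 + x) * (real k + 1 + y))"
  proof -
    have "1 / (1 + branch k x) = (k + x) / (k + 1 + x)" "1 / (1 + branch k y) = (k + y) / (k + 1 + y)"
      using assms by (auto simp: branch_def field_simps)
    moreover have "(k + x) / (k + 1 + x) - (k + y) / (k + 1 + y) = (x - y) / ((real k + 1 + x) * (real k + 1 + y))"
      using assms by (simp add: field_simps)
    ultimately show ?thesis
      using assms unfolding cdist_def by (simp add: abs_mult)
  qed
  \<comment> \<open>k \<ge> 1 and x \<le> 1 give k + 1 + x \<ge> 3/2 (1 + x); the product gains 9/4,
    of which 2 is kept.\<close>
  have "3 / 2 * (1 + x) * (3 / 2 * (1 + y)) \<le> (real k + 1 + x) * (real k + 1 + y)"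
    using assms by (intro mult_mono) auto
  moreover have "0 \<le> (1 + x) * (1 + y)" using assms by simp
  ultimately have "2 * ((1 + x) * (1 + y)) \<le> (real k + 1 + x) * (real k + 1 + y)"
    by linarith
  moreover have "0 < (1 + x) * (1 + y)" using assms by (intro mult_pos_pos) auto
  ultimately have "\<bar>x - y\<bar> / ((real k + 1 + x) * (real k + 1 + y)) \<le> \<bar>x - y\<bar> / (2 * ((1 + x) * (1 + y)))"
    using assms by (intro divide_left_mono mult_pos_pos) auto
  then show ?thesis
    using assms by (simp add: e cdist_eq mult.commute)
qed

lemma chain_cdist:
  assumes "chain a y n" "chain a z n" "i \<le> n"
  shows "cdist (y i) (z i) \<le> (1 / 2) ^ (n - i) * cdist (y n) (z n)"
  using assms(3)
proof (induction i rule: inc_induct)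
  case (step i)
  have "cdist (y i) (z i) \<le> cdist (y (Suc i)) (z (Suc i)) / 2"
    using assms(1,2) step(2) cdist_branch[of "a i" "y (Suc i)" "z (Suc i)"]
    by (auto simp: chain_def)
  moreover have "n - i = Suc (n - Suc i)" using step by simp
  ultimately show ?case using step by simp
qed simp

lemma chain_contract:
  assumes "chain a y n" "chain a z n" "i \<le> n"
  shows "\<bar>y i - z i\<bar> \<le> 4 * (1 / 2) ^ (n - i) * \<bar>y n - z n\<bar>"
proof -
  have u: "y i \<in> {0..1}" "z i \<in> {0..1}" "y n \<in> {0..1}" "z n \<in> {0..1}"
    using assms by (auto simp: chain_def)
  have "\<bar>y i - z i\<bar> \<le> 4 * cdist (y i) (z i)" by (rule cdist_ge[OF u(1,2)])
  also have "\<dots> \<le> 4 * ((1 / 2) ^ (n - i) * cdist (y n) (z n))"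
    using chain_cdist[OF assms] by simp
  also have "\<dots> \<le> 4 * ((1 / 2) ^ (n - i) * \<bar>y n - z n\<bar>)"
    using cdist_le[OF u(3,4)] by simp
  finally show ?thesis by simp
qed

lemma chain_cong:
  assumes "chain a y n" "\<And>i. i < n \<Longrightarrow> b i = a i"
  shows "chain b y n"
  using assms by (auto simp: chain_def)

lemma chain_exists:
  assumes "\<And>i. i < n \<Longrightarrow> 1 \<le> a i" "x \<in> {0..1}"
  obtains y where "chain a y n" "y n = x"
proof -
  have "\<exists>y. chain a y n \<and> y n = x"
    using assms
  proof (induction n arbitrary: x)
    case 0
    then show ?case by (intro exI[of _ "\<lambda>_. x"]) (auto simp: chain_def)
  next
    case (Suc n)
    have "branch (a n) x \<in> {0..1}" using Suc.prems by (intro branch_unit') auto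
    then obtain y where y: "chain a y n" "y n = branch (a n) x"
      using Suc by (metis less_SucI)
    have "chain a (y(Suc n := x)) (Suc n)"
      using y Suc.prems by (auto simp: chain_def less_Suc_eq le_Suc_eq)
    then show ?case by (metis fun_upd_same)
  qed
  then show thesis using that by blast
qed

section \<open>Infinite continued fractions and periodic digit sequences\<close>

primrec approximant :: "nat \<Rightarrow> (nat \<Rightarrow> nat) \<Rightarrow> real" where
  "approximant 0 a = 0"
| "approximant (Suc k) a = branch (a 0) (approximant k (\<lambda>i. a (Suc i)))"

definition cfrac :: "(nat \<Rightarrow> nat) \<Rightarrow> real" where
  "cfrac a = lim (\<lambda>k. approximant k a)"

lemma approximant_unit:
  assumes "\<And>i. 1 \<le> a i"
  shows "approximant k a \<in> {0..1}"
  using assms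
proof (induction k arbitrary: a)
  case (Suc k)
  have "approximant k (\<lambda>i. a (Suc i)) \<in> {0..1}" using Suc by auto
  then show ?case using branch_unit'[of "a 0"] Suc(2) by simp
qed simp

text \<open>Both approximants apply the same first \<open>k\<close> branches, to two points of the
  unit interval whose distance is at most 1.\<close>

lemma approximant_cdist:
  assumes "\<And>i. 1 \<le> a i"
  shows "cdist (approximant k a) (approximant (k + j) a) \<le> (1 / 2) ^ k"
  using assms
proof (induction k arbitrary: a)
  case 0
  then show ?case
    using cdist_le[of "approximant 0 a" "approximant j a"] approximant_unit[of a j] by auto
next
  case (Suc k)
  have "cdist (approximant k (\<lambda>i. a (Suc i))) (approximant (k + j) (\<lambda>i. a (Suc i))) \<le> (1 / 2) ^ k"
    using Suc by auto
  then show ?case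
    using cdist_branch[of "a 0" "approximant k (\<lambda>i. a (Suc i))" "approximant (k + j) (\<lambda>i. a (Suc i))"]
      approximant_unit[of "\<lambda>i. a (Suc i)"] Suc(2) by force
qed

lemma approximant_LIMSEQ:
  assumes "\<And>i. 1 \<le> a i"
  shows "(\<lambda>k. approximant k a) \<longlonglongrightarrow> cfrac a"
proof -
  have "Cauchy (\<lambda>k. approximant k a)"
  proof (rule metric_CauchyI)
    fix e :: real assume "0 < e"
    then obtain M where M: "(1 / 2 :: real) ^ M < e / 4"
      using real_arch_pow_inv[of "e / 4" "1 / 2"] by auto
    have "dist (approximant m a) (approximant n a) < e" if "m \<ge> M" "m \<le> n" for m n
    proof -
      have "dist (approximant m a) (approximant n a) \<le> 4 * cdist (approximant m a) (approximant n a)"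
        using cdist_ge approximant_unit assms unfolding dist_real_def by blast
      also have "\<dots> \<le> 4 * (1 / 2) ^ m"
        using approximant_cdist[of a m "n - m"] assms that by simp
      also have "\<dots> \<le> 4 * (1 / 2) ^ M" using that by (simp add: power_decreasing)
      finally show ?thesis using M by simp
    qed
    then show "\<exists>M. \<forall>m\<ge>M. \<forall>n\<ge>M. dist (approximant m a) (approximant n a) < e"
      by (metis dist_commute nle_le)
  qed
  then show ?thesis
    using Cauchy_convergent convergent_LIMSEQ_iff cfrac_def by metis
qed

lemma cfrac_unit:
  assumes "\<And>i. 1 \<le> a i"
  shows "cfrac a \<in> {0..1}"
  by (rule closed_sequentially[OF closed_real_atLeastAtMost _ approximant_LIMSEQ])
    (use approximant_unit assms in blast)+

lemma cfrac_rec: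
  assumes "\<And>i. 1 \<le> a i"
  shows "cfrac a = branch (a 0) (cfrac (\<lambda>i. a (Suc i)))"
proof -
  have "(\<lambda>k. approximant k (\<lambda>i. a (Suc i))) \<longlonglongrightarrow> cfrac (\<lambda>i. a (Suc i))"
    by (rule approximant_LIMSEQ) (use assms in auto)
  then have "(\<lambda>k. branch (a 0) (approximant k (\<lambda>i. a (Suc i)))) \<longlonglongrightarrow> branch (a 0) (cfrac (\<lambda>i. a (Suc i)))"
    unfolding branch_def using cfrac_unit[of "\<lambda>i. a (Suc i)"] assms[of 0] assms
    by (intro tendsto_intros) force+
  then have "(\<lambda>k. approximant (Suc k) a) \<longlonglongrightarrow> branch (a 0) (cfrac (\<lambda>i. a (Suc i)))" by simp
  moreover have "(\<lambda>k. approximant (Suc k) a) \<longlonglongrightarrow> cfrac a"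
    using approximant_LIMSEQ[OF assms] by (rule LIMSEQ_Suc)
  ultimately show ?thesis by (rule LIMSEQ_unique[symmetric])
qed

text \<open>Coding of orbits: the Gauss map becomes the shift of the index \<open>i\<close>.\<close>

definition tail :: "(nat \<Rightarrow> nat) \<Rightarrow> nat \<Rightarrow> real" where
  "tail a i = cfrac (\<lambda>k. a (i + k))"

lemma tail_unit: "(\<And>i. 1 \<le> a i) \<Longrightarrow> tail a i \<in> {0..1}"
  unfolding tail_def by (rule cfrac_unit) auto

lemma tail_rec: "(\<And>i. 1 \<le> a i) \<Longrightarrow> tail a i = branch (a i) (tail a (Suc i))"
  unfolding tail_def by (subst cfrac_rec) auto

lemma tail_gt_0: "(\<And>i. 1 \<le> a i) \<Longrightarrow> 0 < tail a i"
  using tail_rec[of a i] branch_unit[of "a i" "tail a (Suc i)"] tail_unit[of a "Suc i"] by auto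

text \<open>Strictness makes the digit readable from the point: if \<open>tail a (Suc i)\<close>
  were 1, the floor of \<open>1 / tail a i\<close> would be \<open>a i + 1\<close>.\<close>

lemma tail_lt_1:
  assumes "\<And>i. 1 \<le> a i"
  shows "tail a i < 1"
proof -
  have "1 \<le> real (a i)" "0 < tail a (Suc i)"
    using assms[of i] tail_gt_0[of a "Suc i"] assms by auto
  then have "1 < real (a i) + tail a (Suc i)" by linarith
  then show ?thesis
    using tail_rec[of a i] assms by (simp add: branch_def)
qed

lemma chain_tail:
  assumes "\<And>i. 1 \<le> a i"
  shows "chain (\<lambda>k. a (i + k)) (\<lambda>k. tail a (i + k)) n"
  unfolding chain_def
proof (intro conjI allI impI)
  show "tail a (i + k) = branch (a (i + k)) (tail a (i + Suc k))" for k
    using tail_rec[of a "i + k"] assms by simp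
qed (use tail_unit assms in blast)+

lemma chain_tail_0: "(\<And>i. 1 \<le> a i) \<Longrightarrow> chain a (tail a) n"
  using chain_tail[of a 0 n] by simp

lemma gauss_tail:
  assumes "\<And>i. 1 \<le> a i"
  shows "gauss_map (tail a i) = tail a (Suc i)"
proof -
  have t: "0 < tail a (Suc i)" "tail a (Suc i) < 1" "0 < tail a i"
    using tail_gt_0 tail_lt_1 assms by blast+
  have "1 / tail a i = real (a i) + tail a (Suc i)"
    using tail_rec[of a i] assms by (simp add: branch_def)
  moreover have "\<lfloor>real (a i) + tail a (Suc i)\<rfloor> = int (a i)"
    using t by (intro floor_unique) auto
  ultimately show ?thesis using t by (simp add: gauss_map_def)
qed

text \<open>\<open>n\<close> is any period, not necessarily the least. Distinctness of the orbit
  points is obtained later from a gap condition.\<close>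

definition periodic :: "(nat \<Rightarrow> nat) \<Rightarrow> nat \<Rightarrow> bool" where
  "periodic a n \<longleftrightarrow> 0 < n \<and> (\<forall>i. 1 \<le> a i) \<and> (\<forall>i. a (i + n) = a i)"

lemma periodic_ge_1: "periodic a n \<Longrightarrow> 1 \<le> a i"
  by (simp add: periodic_def)

lemma periodic_tail: "periodic a n \<Longrightarrow> tail a (i + n) = tail a i"
proof -
  assume p: "periodic a n"
  have "a (i + n + k) = a (i + k)" for k
    using p unfolding periodic_def by (metis add.assoc add.commute)
  then show ?thesis by (simp add: tail_def)
qed

lemma periodic_tail_mult: "periodic a n \<Longrightarrow> tail a (i + r * n) = tail a i"
proof (induction r)
  case (Suc r)
  then show ?case using periodic_tail[of a n "i + r * n"] by (simp add: algebra_simps)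
qed simp

lemma periodic_mod:
  assumes "\<And>i. i < n \<Longrightarrow> 1 \<le> a i" "0 < n"
  shows "periodic (\<lambda>i. a (i mod n)) n"
  using assms by (simp add: periodic_def)

section \<open>Summing powers of distances along contracting chains\<close>

lemma powr_add_le:
  fixes x y :: real
  assumes "0 < \<alpha>" "\<alpha> \<le> 1" "0 \<le> x" "0 \<le> y"
  shows "(x + y) powr \<alpha> \<le> x powr \<alpha> + y powr \<alpha>"
proof (cases "x + y = 0")
  case False
  define s where "s = x + y"
  have s: "0 < s" using False assms by (simp add: s_def)
  have le: "t / s \<le> (t / s) powr \<alpha>" if "0 \<le> t" "t \<le> s" for t
    using powr_mono'[of \<alpha> 1 "t / s"] that s assms by auto
  have "1 = x / s + y / s" using s by (simp add: s_def add_divide_distrib[symmetric])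
  also have "\<dots> \<le> (x / s) powr \<alpha> + (y / s) powr \<alpha>"
    using le[of x] le[of y] assms by (auto simp: s_def)
  also have "\<dots> = (x powr \<alpha> + y powr \<alpha>) / s powr \<alpha>"
    using assms s by (simp add: powr_divide add_divide_distrib)
  finally show ?thesis using s by (simp add: s_def pos_le_divide_eq)
qed (use assms in auto)

text \<open>The exponents are reversed because distances along a chain shrink away from its end.\<close>

lemma sum_half_powr_le:
  fixes K :: real
  assumes "0 < \<alpha>" "0 \<le> K"
  shows "(\<Sum>i<n. (K * (1 / 2) ^ (n - i)) powr \<alpha>) \<le> K powr \<alpha> / (1 - (1 / 2) powr \<alpha>)"
proof -
  define r :: real where "r = (1 / 2) powr \<alpha>"
  have r: "0 < r" "r < 1" using assms using powr_less_mono2[of \<alpha> "1 / 2" 1] by (auto simp: r_def)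
  have "(\<Sum>i<n. (K * (1 / 2) ^ (n - i)) powr \<alpha>) = (\<Sum>i<n. K powr \<alpha> * r ^ (n - i))"
    using assms by (intro sum.cong refl)
      (simp add: powr_mult r_def powr_power powr_powr mult.commute flip: powr_realpow)
  also have "\<dots> = K powr \<alpha> * (\<Sum>i<n. r ^ Suc i)"
    unfolding sum_distrib_left[symmetric]
    by (subst sum.nat_diff_reindex[symmetric]) (auto intro!: arg_cong2[where f="(*)"] sum.cong)
  also have "(\<Sum>i<n. r ^ Suc i) \<le> 1 / (1 - r)"
  proof -
    have "(\<Sum>i<n. r ^ Suc i) = r * (\<Sum>i<n. r ^ i)" by (simp add: sum_distrib_left)
    also have "(\<Sum>i<n. r ^ i) = (1 - r ^ n) / (1 - r)" using r by (simp add: sum_gp_strict)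
    also have "r * \<dots> \<le> 1 * (1 / (1 - r))"
      using r by (intro mult_mono divide_right_mono) (auto simp: power_le_one)
    finally show ?thesis by simp
  qed
  finally show ?thesis using assms by (simp add: r_def mult_left_mono)
qed

section \<open>Sub-actions\<close>

definition hoelder :: "real \<Rightarrow> real \<Rightarrow> (real \<Rightarrow> real) \<Rightarrow> bool" where
  "hoelder \<alpha> H f \<longleftrightarrow> (\<forall>x\<in>{0..1}. \<forall>y\<in>{0..1}. \<bar>f x - f y\<bar> \<le> H * \<bar>x - y\<bar> powr \<alpha>)"

lemma hoelderD:
  "hoelder \<alpha> H f \<Longrightarrow> x \<in> {0..1} \<Longrightarrow> y \<in> {0..1} \<Longrightarrow> \<bar>f x - f y\<bar> \<le> H * \<bar>x - y\<bar> powr \<alpha>"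
  by (simp add: hoelder_def)

lemma hoelder_nonneg: "hoelder \<alpha> H f \<Longrightarrow> 0 \<le> H"
  using hoelderD[of \<alpha> H f 0 1] by simp

lemma hoelder_add:
  assumes "hoelder \<alpha> H f" "hoelder \<alpha> K g"
  shows "hoelder \<alpha> (H + K) (\<lambda>x. f x + g x)"
  unfolding hoelder_def
proof (intro ballI)
  fix x y :: real assume "x \<in> {0..1}" "y \<in> {0..1}"
  then show "\<bar>f x + g x - (f y + g y)\<bar> \<le> (H + K) * \<bar>x - y\<bar> powr \<alpha>"
    using hoelderD[OF assms(1), of x y] hoelderD[OF assms(2), of x y] unfolding distrib_right by linarith
qed

lemma hoelder_cmult:
  assumes "hoelder \<alpha> H f"
  shows "hoelder \<alpha> (\<bar>r\<bar> * H) (\<lambda>x. r * f x)"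
  using assms unfolding hoelder_def
  by (simp add: abs_mult mult.assoc mult_left_mono flip: right_diff_distrib)

lemma hoelder_continuous:
  assumes "0 < \<alpha>" "hoelder \<alpha> H f"
  shows "continuous_on {0..1} f"
  unfolding continuous_on_def
proof
  fix x :: real assume x: "x \<in> {0..1}"
  have "((\<lambda>y. H * \<bar>y - x\<bar> powr \<alpha>) \<longlongrightarrow> H * \<bar>x - x\<bar> powr \<alpha>) (at x within {0..1})"
    using assms by (intro tendsto_intros tendsto_powr') auto
  then have "((\<lambda>y. H * \<bar>y - x\<bar> powr \<alpha>) \<longlongrightarrow> 0) (at x within {0..1})" by simp
  then have "((\<lambda>y. f y - f x) \<longlongrightarrow> 0) (at x within {0..1})"
    by (rule Lim_null_comparison[rotated])
      (use hoelderD[OF assms(2) _ x] in \<open>auto simp: eventually_at_filter\<close>)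
  then show "(f \<longlongrightarrow> f x) (at x within {0..1})" by (simp add: LIM_zero_iff)
qed

text \<open>The constant of bounded distortion: a geometric series with ratio
  \<open>(1 / 2) powr \<alpha>\<close>. The 8 is twice the factor 4 of
  \<open>chain_contract\<close>, so that one constant also serves sums shifted by one index.\<close>

definition distortion :: "real \<Rightarrow> real" where
  "distortion \<alpha> = 8 powr \<alpha> / (1 - (1 / 2) powr \<alpha>)"

lemma distortion_pos: "0 < \<alpha> \<Longrightarrow> 0 < distortion \<alpha>"
  using powr_less_mono2[of \<alpha> "1 / 2" 1] by (simp add: distortion_def)

lemma chain_unit: "chain a y n \<Longrightarrow> i \<le> n \<Longrightarrow> y i \<in> {0..1}"
  by (simp add: chain_def)

text \<open>The first sum is for Birkhoff sums; the shifted one is for costs, which are evaluated at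
  the image point \<open>y (Suc i)\<close>.\<close>

lemma chain_sum_powr:
  assumes "0 < \<alpha>" "chain a y n" "chain a z n"
  shows "(\<Sum>i<n. \<bar>y i - z i\<bar> powr \<alpha>) \<le> distortion \<alpha> * \<bar>y n - z n\<bar> powr \<alpha>"
    and "(\<Sum>i<n. \<bar>y (Suc i) - z (Suc i)\<bar> powr \<alpha>) \<le> distortion \<alpha> * \<bar>y n - z n\<bar> powr \<alpha>"
proof -
  have s: "(\<Sum>i<n. (8 * \<bar>y n - z n\<bar> * (1 / 2) ^ (n - i)) powr \<alpha>) \<le> distortion \<alpha> * \<bar>y n - z n\<bar> powr \<alpha>"
    using sum_half_powr_le[of \<alpha> "8 * \<bar>y n - z n\<bar>" n] assms by (simp add: distortion_def powr_mult)
  have "\<bar>y i - z i\<bar> powr \<alpha> \<le> (8 * \<bar>y n - z n\<bar> * (1 / 2) ^ (n - i)) powr \<alpha>" if "i < n" for i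
  proof -
    have "\<bar>y i - z i\<bar> \<le> 4 * (1 / 2) ^ (n - i) * \<bar>y n - z n\<bar>"
      using chain_contract[OF assms(2,3)] that by simp
    also have "\<dots> \<le> 8 * (1 / 2) ^ (n - i) * \<bar>y n - z n\<bar>" by (intro mult_right_mono) auto
    finally show ?thesis using assms(1) by (intro powr_mono2) (auto simp: mult_ac)
  qed
  then show "(\<Sum>i<n. \<bar>y i - z i\<bar> powr \<alpha>) \<le> distortion \<alpha> * \<bar>y n - z n\<bar> powr \<alpha>"
    by (intro order.trans[OF sum_mono s]) auto
  have "\<bar>y (Suc i) - z (Suc i)\<bar> powr \<alpha> \<le> (8 * \<bar>y n - z n\<bar> * (1 / 2) ^ (n - i)) powr \<alpha>" if "i < n" for i
  proof -
    have "\<bar>y (Suc i) - z (Suc i)\<bar> \<le> 4 * (1 / 2) ^ (n - Suc i) * \<bar>y n - z n\<bar>"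
      using chain_contract[OF assms(2,3), of "Suc i"] that by simp
    also have "\<dots> = 8 * \<bar>y n - z n\<bar> * (1 / 2) ^ (n - i)"
      using that by (simp add: Suc_diff_Suc[symmetric])
    finally show ?thesis using assms(1) by (intro powr_mono2) auto
  qed
  then show "(\<Sum>i<n. \<bar>y (Suc i) - z (Suc i)\<bar> powr \<alpha>) \<le> distortion \<alpha> * \<bar>y n - z n\<bar> powr \<alpha>"
    by (intro order.trans[OF sum_mono s]) auto
qed

lemma chain_sum_hoelder:
  assumes "0 < \<alpha>" "hoelder \<alpha> H f" "chain a y n" "chain a z n"
  shows "\<bar>(\<Sum>i<n. f (y i)) - (\<Sum>i<n. f (z i))\<bar> \<le> distortion \<alpha> * H * \<bar>y n - z n\<bar> powr \<alpha>"
proof -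
  have "\<bar>(\<Sum>i<n. f (y i)) - (\<Sum>i<n. f (z i))\<bar> \<le> (\<Sum>i<n. \<bar>f (y i) - f (z i)\<bar>)"
    unfolding sum_subtractf[symmetric] by (rule sum_abs)
  also have "\<dots> \<le> (\<Sum>i<n. H * \<bar>y i - z i\<bar> powr \<alpha>)"
    using chain_unit[OF assms(3)] chain_unit[OF assms(4)]
    by (intro sum_mono hoelderD[OF assms(2)]) (auto simp del: atLeastAtMost_iff)
  also have "\<dots> = H * (\<Sum>i<n. \<bar>y i - z i\<bar> powr \<alpha>)" by (simp add: sum_distrib_left)
  also have "\<dots> \<le> H * (distortion \<alpha> * \<bar>y n - z n\<bar> powr \<alpha>)"
    using chain_sum_powr(1)[OF assms(1,3,4)] hoelder_nonneg[OF assms(2)] by (intro mult_left_mono)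
  finally show ?thesis by (simp add: mult_ac)
qed

text \<open>The sub-action is the supremum of the Birkhoff sums of \<open>f\<close> over all
  finite backward orbits. It is finite since every branch word is shadowed by a periodic orbit.\<close>

lemma subaction_exists:
  assumes \<alpha>: "0 < \<alpha>" and H: "hoelder \<alpha> H f"
    and per: "\<And>a n. periodic a n \<Longrightarrow> (\<Sum>i<n. f (tail a i)) \<le> 0"
  obtains u where "hoelder \<alpha> (distortion \<alpha> * H) u"
    "\<And>k x. 1 \<le> k \<Longrightarrow> x \<in> {0..1} \<Longrightarrow> f (branch k x) + u (branch k x) \<le> u x"
proof -
  define C where "C = distortion \<alpha> * H"
  have C: "0 \<le> C" using distortion_pos[OF \<alpha>] hoelder_nonneg[OF H] by (simp add: C_def)
  define V where "V x = {\<Sum>i<n. f (y i) | a y n. chain a y n \<and> y n = x}" for x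
  define u where "u x = Sup (V x)" for x
  have bound: "(\<Sum>i<n. f (y i)) \<le> C" if c: "chain a y n" for a y n
  proof (cases "n = 0")
    case False
    \<comment> \<open>Repeating the digit word gives a periodic orbit through the same branches. Its
      Birkhoff sum is nonpositive by assumption, and that of the chain differs from it by at most
      the distortion.\<close>
    define b where "b = (\<lambda>i. a (i mod n))"
    have p: "periodic b n"
      unfolding b_def using c False by (intro periodic_mod) (auto simp: chain_def)
    have "chain b (tail b) n" using periodic_ge_1[OF p] by (rule chain_tail_0)
    then have cb: "chain a (tail b) n" by (rule chain_cong) (simp add: b_def)
    have "\<bar>y n - tail b n\<bar> powr \<alpha> \<le> 1"
    proof (rule powr_le1)
      have "y n \<in> {0..1}" "tail b n \<in> {0..1}" using c cb by (auto simp: chain_def)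
      then show "\<bar>\<bar>y n - tail b n\<bar>\<bar> \<le> 1" by auto
    qed (use \<alpha> in auto)
    then have "C * \<bar>y n - tail b n\<bar> powr \<alpha> \<le> C" using C by (simp add: mult_left_le)
    then show ?thesis
      using chain_sum_hoelder[OF \<alpha> H c cb] per[OF p] unfolding C_def[symmetric] by linarith
  qed (use C in simp)
  have bdd: "bdd_above (V x)" for x
    using bound by (intro bdd_aboveI[of _ C]) (auto simp: V_def)
  have ne: "V x \<noteq> {}" if "x \<in> {0..1}" for x
  proof -
    have "chain (\<lambda>_. 1) (\<lambda>_. x) 0" using that by (simp add: chain_def)
    then show ?thesis unfolding V_def by blast
  qed
  \<comment> \<open>A backward orbit ending at \<open>x\<close> is transported to one ending at
    \<open>x'\<close> with the same digits.\<close>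
  have le: "u x \<le> u x' + C * \<bar>x - x'\<bar> powr \<alpha>" if x: "x \<in> {0..1}" "x' \<in> {0..1}" for x x'
    unfolding u_def[of x]
  proof (rule cSup_least[OF ne[OF x(1)]])
    fix s assume "s \<in> V x"
    then obtain a y n where y: "s = (\<Sum>i<n. f (y i))" "chain a y n" "y n = x"
      unfolding V_def by auto
    obtain z where z: "chain a z n" "z n = x'"
      using chain_exists[of n a x'] y(2) x by (auto simp: chain_def)
    have "(\<Sum>i<n. f (z i)) \<in> V x'" unfolding V_def using z by blast
    then have "(\<Sum>i<n. f (z i)) \<le> u x'" unfolding u_def using bdd by (intro cSup_upper)
    then show "s \<le> u x' + C * \<bar>x - x'\<bar> powr \<alpha>"
      using chain_sum_hoelder[OF \<alpha> H y(2) z(1)] y z unfolding C_def by auto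
  qed
  have "hoelder \<alpha> C u"
    unfolding hoelder_def
  proof (intro ballI)
    fix x y :: real assume "x \<in> {0..1}" "y \<in> {0..1}"
    then show "\<bar>u x - u y\<bar> \<le> C * \<bar>x - y\<bar> powr \<alpha>"
      using le[of x y] le[of y x] by (simp add: abs_minus_commute)
  qed
  moreover have "f (branch k x) + u (branch k x) \<le> u x" if k: "1 \<le> k" and x: "x \<in> {0..1}" for k x
  proof -
    have "u (branch k x) \<le> u x - f (branch k x)"
      unfolding u_def[of "branch k x"]
    proof (rule cSup_least[OF ne[OF branch_unit'[OF k x]]])
      fix s assume "s \<in> V (branch k x)"
      then obtain a y n where y: "s = (\<Sum>i<n. f (y i))" "chain a y n" "y n = branch k x"
        unfolding V_def by auto
      \<comment> \<open>A backward orbit ending at \<open>branch k x\<close> is prolonged by one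
        step to end at \<open>x\<close>.\<close>
      define a' y' where "a' = a(n := k)" and "y' = y(Suc n := x)"
      have "chain a' y' (Suc n)"
        using y k x by (auto simp: chain_def less_Suc_eq le_Suc_eq a'_def y'_def)
      moreover have "y' (Suc n) = x" by (simp add: y'_def)
      ultimately have "(\<Sum>i<Suc n. f (y' i)) \<in> V x" unfolding V_def by blast
      moreover have "(\<Sum>i<Suc n. f (y' i)) = s + f (branch k x)"
        using y by (simp add: y'_def)
      ultimately have "s + f (branch k x) \<le> u x"
        unfolding u_def using bdd by (metis cSup_upper)
      then show "s \<le> u x - f (branch k x)" by simp
    qed
    then show ?thesis by simp
  qed
  ultimately show thesis using that C_def by blast
qed

section \<open>Integrals against invariant measures\<close>

lemma gauss_map_unit: "x \<in> {0..1} \<Longrightarrow> gauss_map x \<in> {0..1}"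
  using measurable_space[OF gauss_map_measurable, of x] by (simp add: space_restrict_space)

lemma branch_gauss:
  assumes "x \<in> {0<..1}"
  shows "1 \<le> nat \<lfloor>1 / x\<rfloor>" "branch (nat \<lfloor>1 / x\<rfloor>) (gauss_map x) = x"
proof -
  have "1 \<le> 1 / x" using assms by auto
  then have f: "1 \<le> \<lfloor>1 / x\<rfloor>" by linarith
  then show "1 \<le> nat \<lfloor>1 / x\<rfloor>" by linarith
  show "branch (nat \<lfloor>1 / x\<rfloor>) (gauss_map x) = x"
    using assms f by (simp add: branch_def gauss_map_def)
qed

lemma space_unit_borel: "space unit_borel = {0..1}"
  by (simp add: space_restrict_space)

lemma invariant_measureD:
  assumes "\<nu> \<in> invariant_measures"
  shows "prob_space \<nu>" "sets \<nu> = sets unit_borel" "space \<nu> = {0..1}" "gauss_map \<in> measurable \<nu> \<nu>"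
    "distr \<nu> \<nu> gauss_map = \<nu>"
proof -
  show s: "prob_space \<nu>" "sets \<nu> = sets unit_borel" "distr \<nu> \<nu> gauss_map = \<nu>"
    using assms by (auto simp: invariant_measures_def)
  show "space \<nu> = {0..1}" using sets_eq_imp_space_eq[OF s(2)] space_unit_borel by simp
  show "gauss_map \<in> measurable \<nu> \<nu>"
    using gauss_map_measurable measurable_cong_sets[OF s(2) s(2)] by simp
qed

lemma hoelder_integrable:
  assumes "0 < \<alpha>" "hoelder \<alpha> H f" "\<nu> \<in> invariant_measures"
  shows "integrable \<nu> f"
proof -
  interpret prob_space \<nu> using invariant_measureD[OF assms(3)] by simp
  have m: "f \<in> borel_measurable \<nu>"
    by (subst measurable_cong_sets[OF invariant_measureD(2)[OF assms(3)] refl])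
      (rule borel_measurable_continuous_on_restrict[OF hoelder_continuous[OF assms(1,2)]])
  have "\<bar>f x\<bar> \<le> \<bar>f 0\<bar> + H" if "x \<in> {0..1}" for x
  proof -
    have "\<bar>x - 0\<bar> powr \<alpha> \<le> 1" using that assms by (intro powr_le1) auto
    then have "H * \<bar>x - 0\<bar> powr \<alpha> \<le> H"
      using hoelder_nonneg[OF assms(2)] by (simp add: mult_left_le)
    then show ?thesis using hoelderD[OF assms(2) that, of 0] by simp
  qed
  then show ?thesis
    using m invariant_measureD(3)[OF assms(3)]
    by (intro integrable_const_bound[where B="\<bar>f 0\<bar> + H"]) auto
qed

lemma integral_gauss:
  fixes f :: "real \<Rightarrow> real"
  assumes "\<nu> \<in> invariant_measures" "integrable \<nu> f"
  shows "integrable \<nu> (\<lambda>x. f (gauss_map x))" "(\<integral>x. f (gauss_map x) \<partial>\<nu>) = (\<integral>x. f x \<partial>\<nu>)"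
proof -
  note i = invariant_measureD[OF assms(1)]
  show "integrable \<nu> (\<lambda>x. f (gauss_map x))"
    by (rule integrable_distr[OF i(4), of f]) (simp add: i(5) assms(2))
  show "(\<integral>x. f (gauss_map x) \<partial>\<nu>) = (\<integral>x. f x \<partial>\<nu>)"
    using integral_distr[OF i(4), of f] borel_measurable_integrable[OF assms(2)] by (simp add: i(5))
qed

text \<open>The digit sequence constantly \<open>Suc k\<close> codes a fixed point at most 1 / (k +
  1); these fixed points tend to 0 and f is continuous.\<close>

lemma value_0_le:
  fixes \<beta> :: real
  assumes "0 < \<alpha>" "hoelder \<alpha> H f" "\<And>a n. periodic a n \<Longrightarrow> (\<Sum>i<n. f (tail a i)) \<le> n * \<beta>"
  shows "f 0 \<le> \<beta>"
proof (rule tendsto_upperbound)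
  define p where "p k = tail (\<lambda>_. Suc k) 0" for k
  have p: "0 \<le> p k" "p k \<le> 1" "p k \<le> 1 / Suc k" for k
  proof -
    have t: "tail (\<lambda>_. Suc k) i \<in> {0..1}" for i by (rule tail_unit) simp
    then show "0 \<le> p k" "p k \<le> 1" by (auto simp: p_def)
    have "p k = branch (Suc k) (tail (\<lambda>_. Suc k) 1)"
      using tail_rec[of "\<lambda>_. Suc k" 0] by (simp add: p_def)
    then show "p k \<le> 1 / Suc k" using t[of 1] by (auto simp: branch_def intro!: divide_left_mono)
  qed
  have "p \<longlonglongrightarrow> 0"
    using p LIMSEQ_inverse_real_of_nat by (intro tendsto_sandwich[of "\<lambda>_. 0" p _ "\<lambda>k. 1 / Suc k"])
      (auto simp: inverse_eq_divide)
  then show "(\<lambda>k. f (p k)) \<longlonglongrightarrow> f 0"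
    using continuous_on_tendsto_compose[OF hoelder_continuous[OF assms(1,2)], of p 0] p by auto
  have "f (p k) \<le> \<beta>" for k
    using assms(3)[of "\<lambda>_. Suc k" 1] by (simp add: periodic_def p_def)
  then show "\<forall>\<^sub>F k in sequentially. f (p k) \<le> \<beta>" by simp
qed simp

lemma revealed_le:
  fixes f u :: "real \<Rightarrow> real"
  assumes "f 0 \<le> \<beta>" "\<And>k x. 1 \<le> k \<Longrightarrow> x \<in> {0..1} \<Longrightarrow> f (branch k x) - \<beta> + u (branch k x) \<le> u x" "x \<in> {0..1}"
  shows "f x - \<beta> + u x \<le> u (gauss_map x)"
proof (cases "x = 0")
  case True
  then show ?thesis using assms(1) by (simp add: gauss_map_def)
next
  case False
  then have "x \<in> {0<..1}" using assms by auto
  then show ?thesis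
    using assms(2)[OF branch_gauss(1) gauss_map_unit[OF assms(3)]] branch_gauss(2) by force
qed

lemma subaction_shift:
  fixes \<beta> :: real
  assumes \<alpha>: "0 < \<alpha>" and H: "hoelder \<alpha> H f"
    and per: "\<And>a n. periodic a n \<Longrightarrow> (\<Sum>i<n. f (tail a i)) \<le> n * \<beta>"
  obtains u where "hoelder \<alpha> (distortion \<alpha> * H) u"
    "\<And>k x. 1 \<le> k \<Longrightarrow> x \<in> {0..1} \<Longrightarrow> f (branch k x) - \<beta> + u (branch k x) \<le> u x"
proof -
  have "hoelder \<alpha> H (\<lambda>x. f x - \<beta>)" using H by (simp add: hoelder_def)
  moreover have "(\<Sum>i<n. f (tail a i) - \<beta>) \<le> 0" if "periodic a n" for a n
    using per[OF that] by (simp add: sum_subtractf)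
  ultimately show thesis using subaction_exists[OF \<alpha>, of H "\<lambda>x. f x - \<beta>"] that by blast
qed

text \<open>Integrating the sub-action inequality cancels \<open>u\<close> by invariance. Thus
  periodic orbits control all invariant measures without any approximation of measures by periodic
  ones.\<close>

lemma invariant_integral_le:
  fixes \<beta> :: real
  assumes \<alpha>: "0 < \<alpha>" and H: "hoelder \<alpha> H f"
    and per: "\<And>a n. periodic a n \<Longrightarrow> (\<Sum>i<n. f (tail a i)) \<le> n * \<beta>"
    and \<nu>: "\<nu> \<in> invariant_measures"
  shows "(\<integral>x. f x \<partial>\<nu>) \<le> \<beta>"
proof -
  obtain u where u: "hoelder \<alpha> (distortion \<alpha> * H) u"
    "\<And>k x. 1 \<le> k \<Longrightarrow> x \<in> {0..1} \<Longrightarrow> f (branch k x) - \<beta> + u (branch k x) \<le> u x"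
    using subaction_shift[OF \<alpha> H per] by metis
  interpret prob_space \<nu> using invariant_measureD[OF \<nu>] by simp
  have if': "integrable \<nu> f" and iu: "integrable \<nu> u"
    using hoelder_integrable[OF \<alpha> _ \<nu>] H u(1) by auto
  note ig = integral_gauss[OF \<nu> iu]
  have "(\<integral>x. f x - \<beta> + u x \<partial>\<nu>) \<le> (\<integral>x. u (gauss_map x) \<partial>\<nu>)"
    using revealed_le[OF value_0_le[OF \<alpha> H per] u(2)] if' iu ig(1) invariant_measureD(3)[OF \<nu>]
    by (intro integral_mono) auto
  then show ?thesis using if' iu ig by (simp add: prob_space)
qed

section \<open>Measures on periodic orbits\<close>

lemma sum_periodic_shift:
  fixes g :: "nat \<Rightarrow> 'a::ab_group_add"
  assumes "\<And>i. g (i + n) = g i"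
  shows "(\<Sum>i<n. g (k + i)) = (\<Sum>i<n. g i)"
proof (induction k)
  case (Suc k)
  have "g k + (\<Sum>i<n. g (k + Suc i)) = (\<Sum>i<n. g (k + i)) + g (k + n)"
    using sum.lessThan_Suc_shift[of "\<lambda>i. g (k + i)" n] by simp
  then show ?case using Suc assms[of k] by (simp add: add.commute)
qed simp

text \<open>Transported from the indices and not from the point set, so that repeated points carry
  multiplicity; invariance and integrals then hold for every period, minimal or not.\<close>

definition per_measure :: "(nat \<Rightarrow> nat) \<Rightarrow> nat \<Rightarrow> real measure" where
  "per_measure a n = distr (uniform_count_measure {..<n}) unit_borel (tail a)"

lemma tail_measurable:
  assumes "periodic a n"
  shows "tail a \<in> measurable (uniform_count_measure {..<n}) unit_borel"
proof -
  have "tail a i \<in> {0..1}" for i using tail_unit periodic_ge_1[OF assms] by blast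
  then show ?thesis
    by (simp add: measurable_def sets_uniform_count_measure space_uniform_count_measure
        space_restrict_space Pi_iff del: atLeastAtMost_iff)
qed

lemma emeasure_per_measure:
  assumes "periodic a n" "A \<in> sets unit_borel"
  shows "emeasure (per_measure a n) A = ennreal (card {i \<in> {..<n}. tail a i \<in> A} / n)"
proof -
  have "tail a -` A \<inter> {..<n} = {i \<in> {..<n}. tail a i \<in> A}" by auto
  then show ?thesis
    using emeasure_distr[OF tail_measurable[OF assms(1)] assms(2)]
      emeasure_uniform_count_measure[of "{..<n}" "{i \<in> {..<n}. tail a i \<in> A}"]
    by (simp add: per_measure_def space_uniform_count_measure subset_iff)
qed

lemma per_measure_invariant:
  assumes p: "periodic a n"
  shows "per_measure a n \<in> invariant_measures"
proof -
  let ?M = "per_measure a n"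
  have n: "0 < n" using p by (simp add: periodic_def)
  have ge: "1 \<le> a i" for i using periodic_ge_1[OF p] .
  interpret U: prob_space "uniform_count_measure {..<n}"
    using n by (intro prob_space_uniform_count_measure) (auto simp: lessThan_empty_iff)
  have pr: "prob_space ?M"
    unfolding per_measure_def by (rule U.prob_space_distr[OF tail_measurable[OF p]])
  have s: "sets ?M = sets unit_borel" by (simp add: per_measure_def)
  have G: "gauss_map \<in> measurable ?M ?M"
    using gauss_map_measurable measurable_cong_sets[OF s s] by simp
  have "distr ?M ?M gauss_map = ?M"
  proof (rule measure_eqI)
    fix A assume "A \<in> sets (distr ?M ?M gauss_map)"
    then have A: "A \<in> sets ?M" by simp
    define g where "g i = (of_bool (tail a i \<in> A) :: real)" for i
    have "real (card {i \<in> {..<n}. gauss_map (tail a i) \<in> A}) = (\<Sum>i<n. g (1 + i))"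
      using gauss_tail[of a, OF ge] by (simp add: g_def Int_def flip: sum.inter_filter)
    also have "\<dots> = (\<Sum>i<n. g i)"
      using periodic_tail[OF p] by (intro sum_periodic_shift) (simp add: g_def)
    also have "\<dots> = real (card {i \<in> {..<n}. tail a i \<in> A})"
      by (simp add: g_def Int_def flip: sum.inter_filter)
    finally have "card {i \<in> {..<n}. gauss_map (tail a i) \<in> A} = card {i \<in> {..<n}. tail a i \<in> A}"
      by simp
    moreover have "{i \<in> {..<n}. tail a i \<in> gauss_map -` A \<inter> space ?M}
        = {i \<in> {..<n}. gauss_map (tail a i) \<in> A}"
      using tail_unit[of a, OF ge] by (auto simp: per_measure_def space_restrict_space)
    ultimately show "emeasure (distr ?M ?M gauss_map) A = emeasure ?M A"
      using emeasure_distr[OF G A] measurable_sets[OF G A] A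
        emeasure_per_measure[OF p, of "gauss_map -` A \<inter> space ?M"] emeasure_per_measure[OF p, of A] s
      by simp
  qed simp
  then show ?thesis using pr s by (simp add: invariant_measures_def)
qed

lemma integral_per_measure:
  assumes "0 < \<alpha>" "hoelder \<alpha> H f" "periodic a n"
  shows "(\<integral>x. f x \<partial>per_measure a n) = (\<Sum>i<n. f (tail a i)) / n"
proof -
  have "f \<in> borel_measurable unit_borel"
    by (rule borel_measurable_continuous_on_restrict[OF hoelder_continuous[OF assms(1,2)]])
  then show ?thesis
    unfolding per_measure_def
    using integral_distr[OF tail_measurable[OF assms(3)], of f]
    by (simp add: integral_uniform_count_measure)
qed

lemma per_measure_eq_orbit_measure:
  assumes p: "periodic a n" and inj: "inj_on (tail a) {..<n}"
  shows "per_measure a n = orbit_measure (tail a ` {..<n})"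
proof (rule measure_eqI)
  let ?S = "tail a ` {..<n}"
  fix A assume "A \<in> sets (per_measure a n)"
  then have A: "A \<in> sets unit_borel" by (simp add: per_measure_def)
  have S: "?S \<subseteq> {0..1}" using tail_unit periodic_ge_1[OF p] by blast
  then have m: "(\<lambda>x. x) \<in> measurable (uniform_count_measure ?S) unit_borel"
    by (auto simp: measurable_def sets_uniform_count_measure space_uniform_count_measure
        space_restrict_space)
  have "A \<inter> ?S = tail a ` {i \<in> {..<n}. tail a i \<in> A}" by auto
  moreover have "inj_on (tail a) {i \<in> {..<n}. tail a i \<in> A}"
    by (rule inj_on_subset[OF inj]) auto
  ultimately have "card (A \<inter> ?S) = card {i \<in> {..<n}. tail a i \<in> A}"
    by (simp add: card_image)
  then show "emeasure (per_measure a n) A = emeasure (orbit_measure ?S) A"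
    using emeasure_distr[OF m A] inj
    by (simp add: orbit_measure_def space_uniform_count_measure emeasure_uniform_count_measure
        emeasure_per_measure[OF p A] card_image)
qed (simp add: per_measure_def orbit_measure_def)

lemma gauss_funpow_tail:
  assumes "\<And>i. 1 \<le> a i"
  shows "(gauss_map ^^ k) (tail a 0) = tail a k"
  using gauss_tail[of a, OF assms] by (induction k) auto

lemma periodic_orbit_tail:
  assumes "periodic a n"
  shows "periodic_orbit (tail a ` {..<n})"
proof -
  note k = gauss_funpow_tail[of a, OF periodic_ge_1[OF assms]]
  have "(gauss_map ^^ n) (tail a 0) = tail a 0" using k periodic_tail[OF assms, of 0] by simp
  moreover have "tail a ` {..<n} = (\<lambda>k. (gauss_map ^^ k) (tail a 0)) ` {..<n}" using k by simp
  moreover have "0 < n" using assms by (simp add: periodic_def)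
  moreover have "tail a 0 \<in> {0..1}" using tail_unit periodic_ge_1[OF assms] by blast
  ultimately show ?thesis unfolding periodic_orbit_def by blast
qed

text \<open>An orbit point lies in the preimage of its successor, so by invariance the point masses
  do not decrease along the orbit; going once around the cycle makes them all equal.\<close>

lemma invariant_on_orbit_unique:
  assumes p: "periodic a n" and inj: "inj_on (tail a) {..<n}" and \<nu>: "\<nu> \<in> invariant_measures"
    and ae: "AE x in \<nu>. x \<in> tail a ` {..<n}"
  shows "\<nu> = per_measure a n"
proof -
  note i = invariant_measureD[OF \<nu>]
  interpret prob_space \<nu> by (rule i(1))
  let ?S = "tail a ` {..<n}"
  have unit: "tail a j \<in> {0..1}" for j using tail_unit periodic_ge_1[OF p] by blast
  have sing: "{tail a j} \<in> sets \<nu>" for j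
    using unit[of j] i(2) by (auto simp: sets_restrict_space_iff)
  define m where "m j = measure \<nu> {tail a j}" for j
  have m_Suc: "m j \<le> m (Suc j)" for j
  proof -
    have "m (Suc j) = measure (distr \<nu> \<nu> gauss_map) {tail a (Suc j)}" by (simp add: m_def i(5))
    also have "\<dots> = measure \<nu> (gauss_map -` {tail a (Suc j)} \<inter> space \<nu>)"
      by (rule measure_distr[OF i(4) sing])
    also have "\<dots> \<ge> m j"
      unfolding m_def
      using measurable_sets[OF i(4) sing[of "Suc j"]] unit[of j] i(3) gauss_tail[of a j, OF periodic_ge_1[OF p]]
      by (intro finite_measure_mono) auto
    finally show ?thesis .
  qed
  have m0: "m j = m 0" if "j < n" for j
  proof -
    have mono: "m j \<le> m k" if "j \<le> k" for j k using lift_Suc_mono_le[of m, OF m_Suc that] .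
    have "m n = m 0" using periodic_tail[OF p, of 0] by (simp add: m_def)
    then show ?thesis using mono[of 0 j] mono[of j n] that by simp
  qed
  have meas: "measure \<nu> B = card {j \<in> {..<n}. tail a j \<in> B} * m 0" if B: "B \<subseteq> ?S" for B
  proof -
    define J where "J = {j \<in> {..<n}. tail a j \<in> B}"
    have e: "tail a ` J = B" using B by (auto simp: J_def)
    have inj': "inj_on (tail a) J" by (rule inj_on_subset[OF inj]) (auto simp: J_def)
    have "measure \<nu> B = (\<Sum>x\<in>B. measure \<nu> {x})"
      using B sing finite_subset[OF B] by (intro finite_measure_eq_sum_singleton) auto
    also have "\<dots> = (\<Sum>j\<in>J. m j)"
      unfolding e[symmetric] by (simp add: sum.reindex[OF inj'] m_def)
    also have "\<dots> = (\<Sum>j\<in>J. m 0)"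
      by (rule sum.cong[OF refl], rule m0) (simp add: J_def)
    finally show ?thesis by (simp add: J_def)
  qed
  have S: "?S \<in> sets \<nu>"
  proof -
    have "(\<Union>j<n. {tail a j}) \<in> sets \<nu>" using sing by (intro sets.finite_UN) auto
    then show ?thesis by (simp add: UNION_singleton_eq_range)
  qed
  have one: "measure \<nu> ?S = 1" using ae prob_eq_1[OF S] by simp
  have "{j \<in> {..<n}. tail a j \<in> ?S} = {..<n}" by auto
  then have nm: "n * m 0 = 1" using meas[of ?S] one by simp
  show ?thesis
  proof (rule measure_eqI)
    show "sets \<nu> = sets (per_measure a n)" using i(2) by (simp add: per_measure_def)
    fix A assume A: "A \<in> sets \<nu>"
    have "measure \<nu> A = measure \<nu> (A \<inter> ?S)"
      using ae A S by (intro finite_measure_eq_AE) auto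
    also have "\<dots> = card {j \<in> {..<n}. tail a j \<in> A \<inter> ?S} * m 0" by (rule meas) simp
    also have "{j \<in> {..<n}. tail a j \<in> A \<inter> ?S} = {j \<in> {..<n}. tail a j \<in> A}" by auto
    also have "card {j \<in> {..<n}. tail a j \<in> A} * m 0 = card {j \<in> {..<n}. tail a j \<in> A} / n"
    proof -
      have "m 0 = 1 / n" using nm by (cases "n = 0") (simp_all add: field_simps)
      then show ?thesis by simp
    qed
    finally show "emeasure \<nu> A = emeasure (per_measure a n) A"
      using emeasure_per_measure[OF p, of A] A i(2) by (simp add: emeasure_eq_measure)
  qed
qed

lemma zero_notin_support_per_measure:
  assumes p: "periodic a n"
  shows "0 \<notin> measure_support (per_measure a n)"
proof -
  let ?S = "tail a ` {..<n}"
  have "0 < tail a j" for j using tail_gt_0 periodic_ge_1[OF p] by blast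
  then have "0 \<in> - ?S" by (auto simp: less_le)
  moreover have "open (- ?S)" by (simp add: finite_imp_closed open_Compl)
  moreover have "emeasure (per_measure a n) (- ?S \<inter> {0..1}) = 0"
  proof -
    have "{i \<in> {..<n}. tail a i \<in> - ?S \<inter> {0..1}} = {}" by auto
    moreover have "- ?S \<inter> {0..1} \<in> sets unit_borel"
      using \<open>open (- ?S)\<close> by (auto simp: sets_restrict_space_iff)
    ultimately show ?thesis using emeasure_per_measure[OF p] by fastforce
  qed
  ultimately show ?thesis
    by (auto simp: measure_support_def per_measure_def space_restrict_space)
qed

text \<open>The real supremum is an upper bound only for a bounded family; the crude bound
  \<open>f 0 + H\<close> on orbit points supplies this through
  \<open>invariant_integral_le\<close>.\<close>

lemma max_integral_upper:
  assumes "0 < \<alpha>" "hoelder \<alpha> H f" "\<nu> \<in> invariant_measures"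
  shows "(\<integral>x. f x \<partial>\<nu>) \<le> max_integral f"
  unfolding max_integral_def
proof (rule cSUP_upper[OF assms(3)])
  have "(\<Sum>i<n. f (tail a i)) \<le> n * (f 0 + H)" if p: "periodic a n" for a n
  proof -
    have "f (tail a i) \<le> f 0 + H" for i
    proof -
      have t: "tail a i \<in> {0..1}" using tail_unit periodic_ge_1[OF p] by blast
      then have "\<bar>tail a i - 0\<bar> powr \<alpha> \<le> 1" using assms(1) by (intro powr_le1) auto
      then have "H * \<bar>tail a i - 0\<bar> powr \<alpha> \<le> H"
        using hoelder_nonneg[OF assms(2)] by (simp add: mult_left_le)
      then show ?thesis using hoelderD[OF assms(2) t, of 0] by simp
    qed
    then show ?thesis using sum_bounded_above[of "{..<n}" "\<lambda>i. f (tail a i)"] by simp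
  qed
  then show "bdd_above ((\<lambda>\<nu>. \<integral>x. f x \<partial>\<nu>) ` invariant_measures)"
    using invariant_integral_le[OF assms(1,2)] by (intro bdd_aboveI2[where M="f 0 + H"]) auto
qed

lemma periodic_sum_le_max:
  assumes "0 < \<alpha>" "hoelder \<alpha> H f" "periodic a n"
  shows "(\<Sum>i<n. f (tail a i)) \<le> n * max_integral f"
  using max_integral_upper[OF assms(1,2) per_measure_invariant[OF assms(3)]]
    integral_per_measure[OF assms] assms(3)
  by (simp add: periodic_def divide_le_eq mult.commute)

section \<open>Short cycles among the factors of a sequence\<close>

lemma relpow_path:
  assumes "\<And>i. (f i, f (Suc i)) \<in> R"
  shows "(f i, f (i + d)) \<in> R ^^ d"
proof (induction d)
  case (Suc d)
  then show ?case using assms[of "i + d"] by (auto intro: relpow_Suc_I)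
qed simp

text \<open>In a directed graph without short closed walks, a short path is determined by its vertex set:
  two paths ordering the same vertices differently would close up to a cycle.\<close>

lemma paths_eq_if_same_vertices:
  assumes f: "\<And>i. (f i, f (Suc i)) \<in> R" and g: "\<And>i. (g i, g (Suc i)) \<in> R"
    and acyc: "\<And>v l. 0 < l \<Longrightarrow> l \<le> 2 * t \<Longrightarrow> (v, v) \<notin> R ^^ l"
    and img: "f ` {..<t} = g ` {..<t}"
  shows "i < t \<Longrightarrow> f i = g i"
proof (induction i rule: less_induct)
  case (less i)
  have neq: "h i' \<noteq> h j" if "\<And>i. (h i, h (Suc i)) \<in> R" "i' < j" "j < t" for h i' j
  proof -
    have "0 < j - i'" "j - i' \<le> 2 * t" using that by linarith+
    then show ?thesis
      using relpow_path[of h R i' "j - i'"] acyc[of "j - i'" "h i'"] that by auto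
  qed
  show ?case
  proof (rule ccontr)
    assume ne: "f i \<noteq> g i"
    obtain j where j: "j < t" "f i = g j" using img less.prems by blast
    obtain j' where j': "j' < t" "g i = f j'" using img less.prems by blast
    have "\<not> j < i" using neq[of f j i] f less j by force
    then have ji: "i < j" using j ne by (metis linorder_neqE_nat)
    have "\<not> j' < i" using neq[of g j' i] g less j' by force
    then have ji': "i < j'" using j' ne by (metis linorder_neqE_nat)
    \<comment> \<open>The paths agree before \<open>i\<close>, so \<open>f i\<close> occurs on
      \<open>g\<close> only later, and \<open>g i\<close> on \<open>f\<close> only later. Going
      along \<open>f\<close> from \<open>f i\<close> to \<open>g i\<close> and back along
      \<open>g\<close> closes a walk.\<close>
    have "(f i, f j') \<in> R ^^ (j' - i)" using relpow_path[of f R i "j' - i"] f ji' by simp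
    moreover have "(f j', f i) \<in> R ^^ (j - i)" using relpow_path[of g R i "j - i"] g ji j j' by simp
    ultimately have cyc: "(f i, f i) \<in> R ^^ ((j' - i) + (j - i))" unfolding relpow_add by blast
    have pos: "0 < (j' - i) + (j - i)" using ji by simp
    have "(j' - i) + (j - i) \<le> 2 * t"
    proof -
      have "j' - i \<le> t" "j - i \<le> t" using j(1) j'(1) by simp_all
      then show ?thesis by simp
    qed
    then show False using acyc[OF pos] cyc by simp
  qed
qed

definition factor :: "(nat \<Rightarrow> nat) \<Rightarrow> nat \<Rightarrow> nat \<Rightarrow> nat list" where
  "factor a m k = map (\<lambda>j. a (k + j)) [0..<m]"

text \<open>An edge says that two blocks occur side by side in \<open>a\<close>, at any position and
  not only at multiples of \<open>m\<close>. A walk may therefore recombine pieces of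
  \<open>a\<close> taken from different places.\<close>

definition factor_graph :: "(nat \<Rightarrow> nat) \<Rightarrow> nat \<Rightarrow> (nat list \<times> nat list) set" where
  "factor_graph a m = {(factor a m k, factor a m (k + m)) | k. True}"

lemma factor_nth: "j < m \<Longrightarrow> factor a m k ! j = a (k + j)"
  by (simp add: factor_def)

lemma length_factor: "length (factor a m k) = m"
  by (simp add: factor_def)

lemma finite_factors:
  assumes "finite (range a)"
  shows "finite (range (factor a m))"
proof (rule finite_subset)
  show "range (factor a m) \<subseteq> {xs. set xs \<subseteq> range a \<and> length xs = m}"
    by (auto simp: factor_def)
  show "finite {xs. set xs \<subseteq> range a \<and> length xs = m}"
    using assms by (rule finite_lists_length_eq)
qed

lemma card_factors_pos: "finite (range a) \<Longrightarrow> 0 < card (range (factor a m))"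
  using finite_factors by (simp add: card_gt_0_iff)

text \<open>A factor of length \<open>t * m\<close> is a path of \<open>t\<close> blocks. Without
  short cycles its blocks are distinct and their set already determines their order, so factors
  inject into the \<open>t\<close>-element sets of blocks.\<close>

lemma card_factors_le_choose:
  assumes fin: "finite (range a)" and m: "0 < m"
    and acyc: "\<And>v l. 0 < l \<Longrightarrow> l \<le> 2 * t \<Longrightarrow> (v, v) \<notin> factor_graph a m ^^ l"
  shows "card (range (factor a (t * m))) \<le> card (range (factor a m)) choose t"
proof -
  define blk where "blk k j = factor a m (k + j * m)" for k j
  define Bl where "Bl k = blk k ` {..<t}" for k
  let ?T = "{T. T \<subseteq> range (factor a m) \<and> card T = t}"
  have path: "(blk k j, blk k (Suc j)) \<in> factor_graph a m" for k j
    unfolding blk_def factor_graph_def by (auto simp: algebra_simps)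
  have det: "factor a (t * m) k = factor a (t * m) k'" if e: "Bl k = Bl k'" for k k'
  proof (rule nth_equalityI)
    fix p assume "p < length (factor a (t * m) k)"
    then have p: "p < t * m" by (simp add: length_factor)
    then have "p div m < t" using m by (simp add: less_mult_imp_div_less)
    then have "blk k (p div m) = blk k' (p div m)"
      using paths_eq_if_same_vertices[OF path path acyc e[unfolded Bl_def]] by blast
    then have "blk k (p div m) ! (p mod m) = blk k' (p div m) ! (p mod m)" by simp
    then have "a (k + p) = a (k' + p)"
      using m by (simp add: blk_def factor_nth add.assoc)
    then show "factor a (t * m) k ! p = factor a (t * m) k' ! p" using p by (simp add: factor_nth)
  qed (simp add: length_factor)
  have finT: "finite ?T" using finite_factors[OF fin, of m] by (simp add: finite_subset)
  have BlT: "range Bl \<subseteq> ?T"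
  proof
    fix T assume "T \<in> range Bl"
    then obtain k where k: "T = blk k ` {..<t}" by (auto simp: Bl_def)
    have "inj_on (blk k) {..<t}"
    proof (rule linorder_inj_onI')
      fix i j assume "i \<in> {..<t}" "j \<in> {..<t}" "i < j"
      moreover from this have "0 < j - i" "j - i \<le> 2 * t" by auto
      ultimately show "blk k i \<noteq> blk k j"
        using relpow_path[of "blk k", OF path, of i "j - i"] acyc[of "j - i" "blk k i"] by auto
    qed
    then have "card T = t" using k by (simp add: card_image)
    then show "T \<in> ?T" using k by (auto simp: blk_def)
  qed
  have "range (factor a (t * m)) = (\<lambda>T. factor a (t * m) (SOME k. Bl k = T)) ` range Bl"
  proof -
    have "factor a (t * m) k = factor a (t * m) (SOME k'. Bl k' = Bl k)" for k
      using someI[of "\<lambda>k'. Bl k' = Bl k" k] by (intro det) auto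
    then show ?thesis by (auto simp: image_image)
  qed
  then have "card (range (factor a (t * m))) \<le> card (range Bl)"
    using card_image_le[OF finite_subset[OF BlT finT]] by metis
  also have "\<dots> \<le> card ?T" using BlT finT by (rule card_mono[rotated])
  also have "\<dots> = card (range (factor a m)) choose t" by (rule n_subsets[OF finite_factors[OF fin]])
  finally show ?thesis .
qed

text \<open>\<open>t ^ t / fact t\<close> is a single term of the exponential series at
  \<open>t\<close>.\<close>

lemma ln_fact_ge:
  assumes "0 < t"
  shows "real t * ln (real t) - real t \<le> ln (fact t)"
proof -
  have "real t ^ t / fact t \<le> exp (real t)"
  proof -
    have "(\<lambda>n. real t ^ n /\<^sub>R fact n) sums exp (real t)" by (rule exp_converges)
    then have "(\<Sum>n\<in>{t}. real t ^ n /\<^sub>R fact n) \<le> exp (real t)"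
      by (intro sum_le_suminf[of "\<lambda>n. real t ^ n /\<^sub>R fact n" "{t}", THEN order.trans])
        (auto simp: sums_iff)
    then show ?thesis by (simp add: field_simps)
  qed
  then have "ln (real t ^ t / fact t) \<le> real t"
    using assms ln_le_cancel_iff[of "real t ^ t / fact t" "exp (real t)"] by simp
  then show ?thesis using assms by (simp add: ln_div ln_realpow)
qed

text \<open>Bressaud and Quas: otherwise \<open>card_factors_le_choose\<close> makes the exponential growth rate of the
  number of factors drop by a fixed amount each time \<open>m\<close> is replaced by \<open>2 ^ (m div q) * m\<close>.\<close>

lemma short_cycle_exists:
  assumes fin: "finite (range a)" and q: "0 < q"
  obtains m v l where "m0 \<le> m" "0 < m" "0 < l" "l \<le> 2 * 2 ^ (m div q)" "(v, v) \<in> factor_graph a m ^^ l"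
proof (rule ccontr)
  note obtained = that
  assume "\<not> thesis"
  then have acyc: "(v, v) \<notin> factor_graph a m ^^ l"
    if "m0 \<le> m" "0 < m" "0 < l" "l \<le> 2 * 2 ^ (m div q)" for m v l
    using obtained that by blast
  define p where "p m = real (card (range (factor a m)))" for m
  define h where "h m = ln (p m) / m" for m
  \<comment> \<open>With x = m / q the drop below needs x / 4 \<le> (x - 1) / 2 - 1, which holds
    from x = 6 on.\<close>
  define M where "M = max m0 (10 * q)"
  have p1: "1 \<le> p m" for m using card_factors_pos[OF fin, of m] by (simp add: p_def)
  have h0: "0 \<le> h m" for m using p1 by (simp add: h_def)
  have drop: "\<exists>m'\<ge>M. h m' \<le> h m - 1 / (4 * q)" if m: "M \<le> m" for m
  proof -
    define t :: nat where "t = 2 ^ (m div q)"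
    have m': "m0 \<le> m" "10 * q \<le> m" "0 < m" using m q by (auto simp: M_def)
    have t: "0 < t" by (simp add: t_def)
    have "card (range (factor a (t * m))) \<le> card (range (factor a m)) choose t"
      using acyc[OF m'(1,3)] by (intro card_factors_le_choose[OF fin m'(3)]) (auto simp: t_def)
    \<comment> \<open>The factorial is the whole gain: its logarithm is at least t (ln t - 1), so
      dividing by \<open>t * m\<close> lowers the growth rate by (ln t - 1) / m, and ln t is about
      (m / q) ln 2.\<close>
    then have "card (range (factor a (t * m))) * fact t \<le> card (range (factor a m)) ^ t"
      using binomial_fact_pow[of "card (range (factor a m))" t] mult_le_mono1 order.trans by blast
    then have "p (t * m) * fact t \<le> p m ^ t"
      unfolding p_def by (metis of_nat_fact of_nat_le_iff of_nat_mult of_nat_power)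
    moreover have pos: "0 < p (t * m)" "0 < p m" using p1[of m] p1[of "t * m"] by linarith+
    ultimately have "ln (p (t * m) * fact t) \<le> ln (p m ^ t)"
      by (subst ln_le_cancel_iff) auto
    then have "ln (p (t * m)) + ln (fact t) \<le> t * ln (p m)"
      using pos by (simp add: ln_mult ln_realpow)
    then have "ln (p (t * m)) \<le> t * (ln (p m) - (ln t - 1))"
      using ln_fact_ge[OF t] by (simp add: algebra_simps)
    then have "h (t * m) \<le> t * (ln (p m) - (ln t - 1)) / (t * m)"
      unfolding h_def of_nat_mult by (rule divide_right_mono) simp
    also have "\<dots> = h m - (ln t - 1) / m" using t m' by (simp add: h_def diff_divide_distrib)
    finally have "h (t * m) \<le> h m - (ln t - 1) / m" .
    moreover have "1 / (4 * q) \<le> (ln t - 1) / m"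
    proof -
      have "real m / q - 1 \<le> real (m div q)"
      proof -
        have "m \<le> q + m div q * q" using dividend_less_div_times[OF q, of m] by simp
        then have "real m \<le> q + real (m div q) * q"
          by (metis of_nat_add of_nat_le_iff of_nat_mult)
        then show ?thesis using q by (simp add: field_simps)
      qed
      moreover have "1 / 2 \<le> ln (2 :: real)" using ln2_ge_two_thirds by simp
      ultimately have "(real m / q - 1) * (1 / 2) \<le> real (m div q) * ln 2"
        using m' q by (intro mult_mono) (auto simp: pos_le_divide_eq)
      also have "\<dots> = ln t" by (simp add: t_def ln_realpow)
      finally have "(real m / q - 1) / 2 - 1 \<le> ln t - 1" by simp
      moreover have "real m / (4 * q) \<le> (real m / q - 1) / 2 - 1"
        using m' q by (simp add: field_simps)
      ultimately have "real m / (4 * q) \<le> ln t - 1" by linarith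
      then show ?thesis using m' by (simp add: pos_le_divide_eq)
    qed
    ultimately have "h (t * m) \<le> h m - 1 / (4 * q)" by linarith
    moreover have "M \<le> t * m" using m t by (simp add: le_trans[OF m])
    ultimately show ?thesis by blast
  qed
  \<comment> \<open>Sufficiently many drops of fixed size would make the nonnegative rate
    \<open>h\<close> negative.\<close>
  have "\<exists>m\<ge>M. h m \<le> h M - k * (1 / (4 * q))" for k :: nat
  proof (induction k)
    case (Suc k)
    then obtain m where m: "M \<le> m" "h m \<le> h M - k * (1 / (4 * q))" by blast
    then obtain m' where "M \<le> m'" "h m' \<le> h m - 1 / (4 * q)" using drop by blast
    moreover have "real (Suc k) * (1 / (4 * q)) = real k * (1 / (4 * q)) + 1 / (4 * q)"
      by (simp only: of_nat_Suc distrib_right mult_1 add.commute)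
    ultimately show ?case using m by (intro exI[of _ m']) auto
  qed auto
  moreover have "0 < 1 / real (4 * q)" using q by simp
  then obtain k :: nat where k: "h M < k * (1 / real (4 * q))"
    using reals_Archimedean3 by blast
  ultimately obtain m where "h m \<le> h M - k * (1 / (4 * q))" by blast
  then show False using h0[of m] k by linarith
qed

text \<open>A window of m + 1 digits meets at most two consecutive blocks, which the edge places
  side by side in \<open>a\<close>. The bound s \<le> m includes one digit more than a block: a cost
  term reads the digit at \<open>i\<close> and then the \<open>m\<close> digits that locate the next
  point.\<close>

lemma cycle_to_periodic:
  assumes m: "0 < m" and l: "0 < l" and cyc: "(v, v) \<in> factor_graph a m ^^ l" and a: "\<And>i. 1 \<le> a i"
  obtains b where "periodic b (l * m)" "\<forall>i. \<exists>k. \<forall>s\<le>m. b (i + s) = a (k + s)"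
proof -
  obtain f where f: "f 0 = v" "f l = v" "\<forall>i<l. (f i, f (Suc i)) \<in> factor_graph a m"
    using cyc unfolding relpow_fun_conv by blast
  define b where "b i = f ((i div m) mod l) ! (i mod m)" for i
  have loc: "\<exists>k. \<forall>s\<le>m. b (i + s) = a (k + s)" for i
  proof -
    define j r where "j = (i div m) mod l" and "r = i mod m"
    have j: "j < l" and r: "r < m" using l m by (auto simp: j_def r_def)
    obtain k where k: "f j = factor a m k" "f (Suc j) = factor a m (k + m)"
      using f(3) j unfolding factor_graph_def by blast
    \<comment> \<open>The walk is closed, so the last block is followed by the block 0
      again.\<close>
    have wrap: "f (Suc (i div m) mod l) = f (Suc j)"
      using f(1,2) j by (cases "Suc j = l") (auto simp: j_def mod_Suc)
    have "b (i + s) = a (k + r + s)" if s: "s \<le> m" for s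
    proof (cases "r + s < m")
      case True
      have i: "i + s = (r + s) + (i div m) * m" by (simp add: r_def)
      have "(i + s) div m = i div m" "(i + s) mod m = r + s"
        using True m by (subst i, simp)+
      then show ?thesis using k(1) True by (simp add: b_def j_def[symmetric] factor_nth add.assoc)
    next
      case False
      have lt: "r + s - m < m" using r s by simp
      have i: "i + s = (r + s - m) + Suc (i div m) * m" using False by (simp add: r_def)
      have "(i + s) div m = Suc (i div m)" "(i + s) mod m = r + s - m"
        using lt m by (subst i, simp del: mult_Suc)+
      then show ?thesis using k(2) lt False by (simp add: b_def wrap factor_nth add.assoc)
    qed
    then show ?thesis by (metis add.assoc)
  qed
  have "periodic b (l * m)"
    unfolding periodic_def
  proof (intro conjI allI)
    show "0 < l * m" using l m by simp
    show "b (i + l * m) = b i" for i using m by (simp add: b_def)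
    show "1 \<le> b i" for i
    proof -
      obtain k where "\<forall>s\<le>m. b (i + s) = a (k + s)" using loc by blast
      then show ?thesis using a[of k] by (metis add.right_neutral zero_le)
    qed
  qed
  then show thesis using loc that by blast
qed

lemma poly_times_exp_small:
  fixes r :: real
  assumes "0 < r" "r < 1" "0 < \<tau>"
  shows "\<exists>m0. \<forall>m\<ge>m0. C * real m ^ S * r ^ m < \<tau>"
proof -
  have "(\<lambda>m::nat. C * real m ^ S * r ^ m) \<longlonglongrightarrow> 0" using assms by real_asymp
  then have "\<forall>\<^sub>F m in sequentially. C * real m ^ S * r ^ m < \<tau>" using assms(3) by (rule order_tendstoD)
  then show ?thesis unfolding eventually_sequentially .
qed

section \<open>Cheap and isolated periodic orbits\<close>

text \<open>\<open>c k x\<close> stands for the defect of the sub-action inequality at the step from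
  \<open>branch k x\<close> to \<open>x\<close>. In terms of the image point it is Hoelder with a
  constant independent of the digit; in terms of the starting point it would involve the Gauss map,
  whose expansion is unbounded.\<close>

locale cost_function =
  fixes \<alpha> B :: real and c :: "nat \<Rightarrow> real \<Rightarrow> real"
  assumes alpha: "0 < \<alpha>" "\<alpha> \<le> 1"
    and c_nonneg: "1 \<le> k \<Longrightarrow> x \<in> {0..1} \<Longrightarrow> 0 \<le> c k x"
    and c_hoelder: "1 \<le> k \<Longrightarrow> hoelder \<alpha> B (c k)"
begin

definition cost :: "(nat \<Rightarrow> nat) \<Rightarrow> nat \<Rightarrow> real" where
  "cost a n = (\<Sum>i<n. c (a i) (tail a (Suc i)))"

lemma B_nonneg: "0 \<le> B"
  using hoelder_nonneg[OF c_hoelder[of 1]] by simp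

lemma c_tail_nonneg: "periodic a n \<Longrightarrow> 0 \<le> c (a i) (tail a j)"
  using c_nonneg periodic_ge_1 tail_unit by metis

lemma cost_nonneg: "periodic a n \<Longrightarrow> 0 \<le> cost a n"
  unfolding cost_def using c_tail_nonneg by (intro sum_nonneg) auto

lemma cost_shift:
  assumes "periodic a n"
  shows "(\<Sum>i<n. c (a (k + i)) (tail a (Suc (k + i)))) = cost a n"
  unfolding cost_def
proof (rule sum_periodic_shift[where g="\<lambda>i. c (a i) (tail a (Suc i))"])
  show "c (a (i + n)) (tail a (Suc (i + n))) = c (a i) (tail a (Suc i))" for i
    using periodic_tail[OF assms, of "Suc i"] assms by (simp add: periodic_def)
qed

lemma cost_term_le:
  assumes "periodic a n"
  shows "c (a i) (tail a (Suc i)) \<le> cost a n"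
proof -
  have "0 < n" using assms by (simp add: periodic_def)
  then have "c (a (i + 0)) (tail a (Suc (i + 0))) \<le> (\<Sum>j<n. c (a (i + j)) (tail a (Suc (i + j))))"
    using c_tail_nonneg[OF assms]
    by (intro member_le_sum[of 0 "{..<n}" "\<lambda>j. c (a (i + j)) (tail a (Suc (i + j)))"]) auto
  then show ?thesis using cost_shift[OF assms, of i] by simp
qed

definition split_const :: real where
  "split_const = B * distortion \<alpha> * 8 powr \<alpha>"

lemma split_const_nonneg: "0 \<le> split_const"
  using B_nonneg distortion_pos[OF alpha(1)] by (simp add: split_const_def)

text \<open>Repeating the \<open>l\<close> digits from position \<open>i\<close> gives an orbit that
  shadows this segment of the old one. The error is governed by the distance at the end of the
  segment, hence by how nearly the segment returns.\<close>

lemma periodic_split: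
  assumes p: "periodic a n" and l: "0 < l" "l < n"
  obtains b where "periodic b l" "range b \<subseteq> range a"
    "cost b l \<le> cost a n + split_const * \<bar>tail a i - tail a (i + l)\<bar> powr \<alpha>"
proof -
  define b where "b k = a (i + k mod l)" for k
  define y where "y k = tail a (i + k)" for k
  have ge: "1 \<le> a k" for k using periodic_ge_1[OF p] .
  have pb: "periodic b l"
    unfolding b_def using ge l by (intro periodic_mod[of l "\<lambda>k. a (i + k)"]) auto
  have ya: "y k \<in> {0..1}" for k using tail_unit[of a, OF ge] by (simp add: y_def)
  have zb: "tail b k \<in> {0..1}" for k using tail_unit periodic_ge_1[OF pb] by blast
  have chy: "chain b y l"
    using chain_tail[of a i l, OF ge] unfolding y_def by (rule chain_cong) (simp add: b_def)
  have chz: "chain b (tail b) l" using periodic_ge_1[OF pb] by (rule chain_tail_0)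
  \<comment> \<open>The \<open>l\<close> branches together contract \<open>cdist\<close> at least by
    1/2, so their fixed point lies within twice the displacement of \<open>y l\<close>; returning to
    the Euclidean distance costs the factor 4.\<close>
  have close: "\<bar>tail b l - y l\<bar> \<le> 8 * \<bar>y 0 - y l\<bar>"
  proof -
    have z: "tail b l = tail b 0" using periodic_tail[OF pb, of 0] by simp
    have "cdist (tail b 0) (y 0) \<le> (1 / 2) ^ l * cdist (tail b l) (y l)"
      using chain_cdist[OF chz chy, of 0] by simp
    also have "\<dots> \<le> 1 / 2 * cdist (tail b l) (y l)"
      using l(1) cdist_nonneg power_decreasing[of 1 l "1 / 2 :: real"] by (intro mult_right_mono) auto
    finally have "cdist (tail b l) (y l) \<le> 2 * cdist (y 0) (y l)"
      using cdist_triangle[of "tail b 0" "y l" "y 0"] unfolding z by linarith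
    moreover have "cdist (y 0) (y l) \<le> \<bar>y 0 - y l\<bar>" using ya by (intro cdist_le)
    moreover have "\<bar>tail b l - y l\<bar> \<le> 4 * cdist (tail b l) (y l)" using ya zb by (intro cdist_ge)
    ultimately have "\<bar>tail b l - y l\<bar> \<le> 4 * (2 * \<bar>y 0 - y l\<bar>)"
      by (meson mult_left_mono order.trans zero_le_numeral)
    then show ?thesis by simp
  qed
  have "cost b l \<le> (\<Sum>k<l. c (a (i + k)) (y (Suc k)) + B * \<bar>tail b (Suc k) - y (Suc k)\<bar> powr \<alpha>)"
    unfolding cost_def
  proof (rule sum_mono)
    fix k assume "k \<in> {..<l}"
    then have "b k = a (i + k)" by (simp add: b_def)
    then show "c (b k) (tail b (Suc k)) \<le> c (a (i + k)) (y (Suc k)) + B * \<bar>tail b (Suc k) - y (Suc k)\<bar> powr \<alpha>"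
      using hoelderD[OF c_hoelder[OF ge[of "i + k"]] zb ya, of "Suc k" "Suc k"] by simp
  qed
  also have "\<dots> = (\<Sum>k<l. c (a (i + k)) (y (Suc k))) + B * (\<Sum>k<l. \<bar>tail b (Suc k) - y (Suc k)\<bar> powr \<alpha>)"
    by (simp add: sum.distrib sum_distrib_left)
  \<comment> \<open>The other terms of the full period are nonnegative.\<close>
  also have "(\<Sum>k<l. c (a (i + k)) (y (Suc k))) \<le> (\<Sum>k<n. c (a (i + k)) (y (Suc k)))"
    using l c_tail_nonneg[OF p] by (intro sum_mono2) (auto simp: y_def)
  also have "\<dots> = cost a n" using cost_shift[OF p, of i] by (simp add: y_def)
  also have "(\<Sum>k<l. \<bar>tail b (Suc k) - y (Suc k)\<bar> powr \<alpha>) \<le> distortion \<alpha> * \<bar>tail b l - y l\<bar> powr \<alpha>"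
    by (rule chain_sum_powr(2)[OF alpha(1) chz chy])
  also have "\<bar>tail b l - y l\<bar> powr \<alpha> \<le> (8 * \<bar>y 0 - y l\<bar>) powr \<alpha>"
    using close alpha by (intro powr_mono2) auto
  also have "\<dots> = 8 powr \<alpha> * \<bar>y 0 - y l\<bar> powr \<alpha>" by (simp add: powr_mult)
  finally have "cost b l \<le> cost a n + split_const * \<bar>tail a i - tail a (i + l)\<bar> powr \<alpha>"
    using B_nonneg distortion_pos[OF alpha(1)]
    by (simp add: split_const_def y_def mult.assoc mult_left_mono)
  moreover have "range b \<subseteq> range a" by (auto simp: b_def)
  ultimately show thesis using that pb by blast
qed

text \<open>The strict inequality keeps the orbit points distinct even when the cost is 0.\<close>

definition isolated :: "real \<Rightarrow> (nat \<Rightarrow> nat) \<Rightarrow> nat \<Rightarrow> bool" where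
  "isolated M a n \<longleftrightarrow> (\<forall>i l. 0 < l \<longrightarrow> l < n \<longrightarrow> M * cost a n < \<bar>tail a i - tail a (i + l)\<bar> powr \<alpha>)"

text \<open>A periodic orbit with two close points splits into two periodic orbits; the shorter one has at
  most half the period and its cost grows at most by the factor \<open>2 ^ s\<close>, so the quantity
  \<open>cost * period ^ s\<close> does not increase.\<close>

lemma isolated_exists:
  assumes M: "0 \<le> M" and s: "1 + split_const * M \<le> 2 ^ s"
  shows "periodic a n \<Longrightarrow> cost a n * real n ^ s < \<tau> \<Longrightarrow>
    \<exists>b m. periodic b m \<and> range b \<subseteq> range a \<and> cost b m < \<tau> \<and> isolated M b m"
proof (induction n arbitrary: a rule: less_induct)
  case (less n)
  note p = less.prems(1)
  have n: "1 \<le> n" using p by (simp add: periodic_def)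
  show ?case
  proof (cases "isolated M a n")
    case True
    have "cost a n * 1 \<le> cost a n * real n ^ s"
      using cost_nonneg[OF p] n by (intro mult_left_mono) (auto simp: one_le_power)
    then show ?thesis using True less.prems by force
  next
    case False
    then obtain i l where l: "0 < l" "l < n" and close: "\<bar>tail a i - tail a (i + l)\<bar> powr \<alpha> \<le> M * cost a n"
      unfolding isolated_def by (auto simp: not_less)
    \<comment> \<open>If the segment is longer than half the period, the complementary one, from the
      second point around to the first, has the same endpoints.\<close>
    obtain j k where k: "0 < k" "2 * k \<le> n" and closek: "\<bar>tail a j - tail a (j + k)\<bar> powr \<alpha> \<le> M * cost a n"
    proof (cases "2 * l \<le> n")
      case True
      then show thesis using that l close by blast
    next
      case False
      have "tail a (i + l + (n - l)) = tail a i" using periodic_tail[OF p, of i] l by simp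
      then show thesis using that[of "n - l" "i + l"] False l close by (simp add: abs_minus_commute)
    qed
    have "k < n" using k by simp
    obtain b where b: "periodic b k" "range b \<subseteq> range a"
      "cost b k \<le> cost a n + split_const * \<bar>tail a j - tail a (j + k)\<bar> powr \<alpha>"
      by (rule periodic_split[OF p k(1) \<open>k < n\<close>])
    note b(3)
    also have "cost a n + split_const * \<bar>tail a j - tail a (j + k)\<bar> powr \<alpha> \<le> cost a n + split_const * (M * cost a n)"
      using closek split_const_nonneg by (intro add_left_mono mult_left_mono)
    also have "\<dots> = (1 + split_const * M) * cost a n" by (simp add: algebra_simps)
    also have "\<dots> \<le> 2 ^ s * cost a n" using s cost_nonneg[OF p] by (intro mult_right_mono)
    finally have "cost b k * real k ^ s \<le> (2 ^ s * cost a n) * real k ^ s" by (intro mult_right_mono) auto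
    also have "\<dots> = cost a n * (2 * real k) ^ s" by (simp add: power_mult_distrib)
    also have "\<dots> \<le> cost a n * real n ^ s"
      using k cost_nonneg[OF p] by (intro mult_left_mono power_mono) linarith+
    finally have "cost b k * real k ^ s < \<tau>" using less.prems by linarith
    from less.IH[OF \<open>k < n\<close> b(1) this] show ?thesis using order.trans[OF _ b(2)] by fast
  qed
qed

text \<open>All windows of length m + 1 of the closed-up orbit occur in \<open>a\<close>, so each
  cost term is at most B (4 / 2 ^ m) powr \<alpha>, while the period is at most 2 m 2 ^ (m / q). For
  large \<open>q\<close> the growth of the period is slower than the decay of the cost.\<close>

lemma cheap_periodic_exists:
  assumes fin: "finite (range a)" and a: "\<And>i. 1 \<le> a i" and x: "\<And>i. x i \<in> {0..1}"
    and orbit: "\<And>i. x i = branch (a i) (x (Suc i))" and zero: "\<And>i. c (a i) (x (Suc i)) = 0"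
    and \<tau>: "0 < \<tau>"
  obtains b n where "periodic b n" "range b \<subseteq> range a" "cost b n * real n ^ s < \<tau>"
proof -
  \<comment> \<open>This makes (m div q) (s + 1) at most \<alpha> m / 2: the powers of the period
    use up only half of the decay 2 powr (- \<alpha> m), and \<open>r ^ m\<close> remains. One of
    the s + 1 powers counts the cost terms, the others are the weight.\<close>
  define q where "q = nat \<lceil>2 * (Suc s) / \<alpha>\<rceil>"
  have q: "2 * Suc s / \<alpha> \<le> q" unfolding q_def by linarith
  have "0 < 2 * real (Suc s) / \<alpha>" using alpha by simp
  then have "0 < real q" using q by linarith
  then have q0: "0 < q" by simp
  define r where "r = 2 powr (- \<alpha> / 2)"
  have r: "0 < r" "r < 1" using alpha using powr_less_mono[of "- \<alpha> / 2" 0 2] by (auto simp: r_def)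
  define C where "C = 2 ^ Suc s * B * 4 powr \<alpha>"
  obtain m0 where m0: "\<forall>m\<ge>m0. C * real m ^ Suc s * r ^ m < \<tau>"
    using poly_times_exp_small[OF r \<tau>] by blast
  obtain m v l where m: "m0 \<le> m" "0 < m" and l: "0 < l" "l \<le> 2 * 2 ^ (m div q)"
    and cyc: "(v, v) \<in> factor_graph a m ^^ l"
    by (rule short_cycle_exists[OF fin q0])
  obtain b where pb: "periodic b (l * m)" and loc: "\<forall>i. \<exists>k. \<forall>s\<le>m. b (i + s) = a (k + s)"
    by (rule cycle_to_periodic[OF m(2) l(1) cyc a])
  have zb: "tail b k \<in> {0..1}" for k using tail_unit periodic_ge_1[OF pb] by blast
  have step: "c (b i) (tail b (Suc i)) \<le> B * (4 * (1 / 2) ^ m) powr \<alpha>" for i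
  proof -
    obtain k where k: "\<forall>s\<le>m. b (i + s) = a (k + s)" using loc by blast
    have k0: "b i = a k" using k by force
    have ch1: "chain (\<lambda>s. a (Suc k + s)) (\<lambda>s. tail b (Suc i + s)) m"
    proof (rule chain_cong[OF chain_tail[of b "Suc i" m, OF periodic_ge_1[OF pb]]])
      fix s assume "s < m"
      then show "a (Suc k + s) = b (Suc i + s)" using k[rule_format, of "Suc s"] by simp
    qed
    have ch2: "chain (\<lambda>s. a (Suc k + s)) (\<lambda>s. x (Suc k + s)) m"
      unfolding chain_def
    proof (intro conjI allI impI)
      show "x (Suc k + s) = branch (a (Suc k + s)) (x (Suc k + Suc s))" for s
        using orbit[of "Suc k + s"] by simp
    qed (use a x in auto)
    have "\<bar>tail b (Suc i) - x (Suc k)\<bar> \<le> 4 * (1 / 2) ^ m * \<bar>tail b (Suc i + m) - x (Suc k + m)\<bar>"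
      using chain_contract[OF ch1 ch2, of 0] by simp
    also have "\<dots> \<le> 4 * (1 / 2) ^ m * 1"
      using zb[of "Suc i + m"] x[of "Suc k + m"] by (intro mult_left_mono) auto
    finally have "\<bar>tail b (Suc i) - x (Suc k)\<bar> powr \<alpha> \<le> (4 * (1 / 2) ^ m) powr \<alpha>"
      using alpha by (intro powr_mono2) auto
    then have "B * \<bar>tail b (Suc i) - x (Suc k)\<bar> powr \<alpha> \<le> B * (4 * (1 / 2) ^ m) powr \<alpha>"
      using B_nonneg by (rule mult_left_mono)
    then show ?thesis
      using hoelderD[OF c_hoelder[OF a[of k]] zb[of "Suc i"] x[of "Suc k"]] zero[of k] k0 by simp
  qed
  have "cost b (l * m) \<le> real (l * m) * (B * (4 * (1 / 2) ^ m) powr \<alpha>)"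
    unfolding cost_def using sum_bounded_above[of "{..<l * m}", OF step] by simp
  then have "cost b (l * m) * real (l * m) ^ s \<le> real (l * m) * (B * (4 * (1 / 2) ^ m) powr \<alpha>) * real (l * m) ^ s"
    by (rule mult_right_mono) simp
  also have "\<dots> = real (l * m) ^ Suc s * (B * (4 * (1 / 2) ^ m) powr \<alpha>)" by simp
  also have "\<dots> \<le> (2 * 2 ^ (m div q) * real m) ^ Suc s * (B * (4 * (1 / 2) ^ m) powr \<alpha>)"
  proof (intro mult_right_mono power_mono)
    have "real l \<le> real (2 * 2 ^ (m div q))" using l(2) by (simp only: of_nat_le_iff)
    then have "real l \<le> 2 * 2 ^ (m div q)" by simp
    then show "real (l * m) \<le> 2 * 2 ^ (m div q) * real m" by (simp add: mult_right_mono)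
  qed (use B_nonneg in auto)
  also have "\<dots> = C * real m ^ Suc s * (2 ^ (m div q * Suc s) * ((1 / 2) ^ m) powr \<alpha>)"
  proof -
    have e1: "(2 * 2 ^ (m div q) * real m) ^ Suc s = 2 ^ Suc s * 2 ^ (m div q * Suc s) * real m ^ Suc s"
      by (simp only: power_mult_distrib power_mult)
    have e2: "(4 * (1 / 2 :: real) ^ m) powr \<alpha> = 4 powr \<alpha> * ((1 / 2) ^ m) powr \<alpha>"
      by (simp add: powr_mult)
    show ?thesis unfolding e1 e2 C_def by (simp only: mult_ac)
  qed
  also have "\<dots> \<le> C * real m ^ Suc s * r ^ m"
  proof (intro mult_left_mono)
    have "real (m div q) \<le> m / q" by (rule of_nat_div_le_of_nat)
    then have "real (m div q) * Suc s \<le> m / q * Suc s" by (intro mult_right_mono) auto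
    also have "\<dots> = (Suc s / q) * m" by simp
    also have "\<dots> \<le> (\<alpha> / 2) * m"
      using q q0 alpha by (intro mult_right_mono) (auto simp: field_simps)
    finally have e: "real (m div q * Suc s) \<le> \<alpha> / 2 * m" by (simp only: of_nat_mult)
    have "2 ^ (m div q * Suc s) * ((1 / 2) ^ m) powr \<alpha> = 2 powr (real (m div q * Suc s)) * 2 powr (- real m * \<alpha>)"
    proof -
      have "((1 / 2 :: real) ^ m) powr \<alpha> = 2 powr (- real m * \<alpha>)"
      proof -
        have "(1 / 2 :: real) ^ m = 2 powr (- real m)"
          by (simp add: powr_minus powr_realpow power_one_over inverse_eq_divide)
        then show ?thesis by (simp only: powr_powr)
      qed
      moreover have "2 powr (real (m div q * Suc s)) = (2 :: real) ^ (m div q * Suc s)"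
        by (rule powr_realpow) simp
      ultimately show ?thesis by (simp only:)
    qed
    also have "\<dots> = 2 powr (real (m div q * Suc s) - real m * \<alpha>)" by (simp flip: powr_add)
    also have "\<dots> \<le> 2 powr (- \<alpha> / 2 * m)" using e by (intro powr_mono) (auto simp: algebra_simps)
    also have "\<dots> = r ^ m" by (simp add: r_def powr_power powr_powr mult.commute flip: powr_realpow)
    finally show "2 ^ (m div q * Suc s) * ((1 / 2) ^ m) powr \<alpha> \<le> r ^ m" .
  qed (use B_nonneg in \<open>auto simp: C_def\<close>)
  also have "\<dots> < \<tau>" using m0 m(1) by blast
  finally have "cost b (l * m) * real (l * m) ^ s < \<tau>" .
  moreover have "range b \<subseteq> range a"
  proof
    fix d assume "d \<in> range b"
    then obtain i where "d = b i" by blast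
    then show "d \<in> range a" using loc by (metis add.right_neutral rangeI zero_le)
  qed
  ultimately show thesis using that pb by blast
qed

end

section \<open>Locking on a periodic orbit\<close>

lemma sum_lessThan_plus:
  fixes g :: "nat \<Rightarrow> 'a::comm_monoid_add"
  shows "(\<Sum>s<K + r. g s) = (\<Sum>s<K. g s) + (\<Sum>s<r. g (K + s))"
  by (induction r) (auto simp: add.assoc)

text \<open>Complete periods contribute 0, and fewer than \<open>n\<close> terms are left.\<close>

lemma periodic_partial_sum_le:
  fixes g :: "nat \<Rightarrow> real"
  assumes n: "0 < n" and per: "\<And>i. g (i + n) = g i" and zero: "(\<Sum>i<n. g i) = 0"
    and E: "\<And>i. g i \<le> E" "0 \<le> E"
  shows "(\<Sum>s<L. g (k + s)) \<le> n * E"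
proof (induction L arbitrary: k rule: less_induct)
  case (less L)
  show ?case
  proof (cases "L < n")
    case True
    have "(\<Sum>s<L. g (k + s)) \<le> L * E"
      using sum_bounded_above[of "{..<L}" "\<lambda>s. g (k + s)" E] E by simp
    also have "\<dots> \<le> n * E" using True E by (intro mult_right_mono) auto
    finally show ?thesis .
  next
    case False
    have "(\<Sum>s<n + (L - n). g (k + s)) = (\<Sum>s<n. g (k + s)) + (\<Sum>s<L - n. g (k + (n + s)))"
      by (rule sum_lessThan_plus)
    also have "(\<Sum>s<n. g (k + s)) = 0" using sum_periodic_shift[of g n k] per zero by simp
    finally have "(\<Sum>s<L. g (k + s)) = (\<Sum>s<L - n. g (k + n + s))" using False by (simp add: add.assoc)
    then show ?thesis using less.IH[of "L - n" "k + n"] False n by simp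
  qed
qed

lemma sum_periods:
  fixes g :: "nat \<Rightarrow> real"
  assumes "\<And>i. g (i + m) = g i"
  shows "(\<Sum>s<k * m. g s) = k * (\<Sum>s<m. g s)"
proof (induction k)
  case (Suc k)
  have "(\<Sum>s<k * m + m. g s) = (\<Sum>s<k * m. g s) + (\<Sum>s<m. g (k * m + s))" by (rule sum_lessThan_plus)
  then show ?case using Suc sum_periodic_shift[of g m "k * m"] assms by (simp add: algebra_simps)
qed simp

text \<open>Digits up to \<open>N\<close> keep the orbit away from 0 and 1, hence from the
  discontinuities of the Gauss map. Nearby points then share the digit, and the distance grows at
  most by \<Lambda>, a bound for 1 / z times 1 / y.\<close>

lemma nearby_digit:
  assumes a: "\<And>i. 1 \<le> a i" "\<And>i. a i \<le> N" and b: "1 \<le> b" and z': "z' \<in> {0..1}" and z: "z = branch b z'"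
    and \<Lambda>: "\<Lambda> = 2 * (real N + 1)\<^sup>2" and close: "\<bar>z - tail a i\<bar> < 1 / (\<Lambda> * (N + 2))"
  shows "b = a i" "\<bar>z' - tail a (Suc i)\<bar> \<le> \<Lambda> * \<bar>z - tail a i\<bar>"
proof -
  define y y' where "y = tail a i" and "y' = tail a (Suc i)"
  have lower: "1 / (real N + 1) \<le> tail a j" for j
  proof -
    have "tail a j = 1 / (real (a j) + tail a (Suc j))"
      using tail_rec[of a j, OF a(1)] by (simp add: branch_def)
    moreover have "real (a j) + tail a (Suc j) \<le> N + 1"
      using tail_unit[of a "Suc j", OF a(1)] a(2)[of j] by simp
    moreover have "0 < real (a j) + tail a (Suc j)"
      using tail_unit[of a "Suc j", OF a(1)] a(1)[of j] by simp
    ultimately show ?thesis by (simp add: frac_le)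
  qed
  have y'1: "y' \<le> 1 - 1 / (real N + 2)"
  proof -
    have "y' = 1 / (real (a (Suc i)) + tail a (Suc (Suc i)))"
      using tail_rec[of a "Suc i", OF a(1)] by (simp add: branch_def y'_def)
    also have "\<dots> \<le> 1 / (1 + 1 / (real N + 1))"
    proof (rule frac_le)
      show "1 + 1 / (real N + 1) \<le> real (a (Suc i)) + tail a (Suc (Suc i))"
        using lower[of "Suc (Suc i)"] a(1)[of "Suc i"] by (intro add_mono) auto
    qed (auto intro: add_pos_nonneg)
    also have "\<dots> = 1 - 1 / (real N + 2)" by (simp add: field_simps)
    finally show ?thesis .
  qed
  have y'0: "1 / (real N + 2) \<le> y'"
  proof -
    have "1 / (real N + 2) \<le> 1 / (real N + 1)" by (simp add: frac_le)
    then show ?thesis using lower[of "Suc i"] by (simp add: y'_def)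
  qed
  have y: "1 / (real N + 1) \<le> y" using lower by (simp add: y_def)
  have yinv: "1 / y = a i + y'"
    using tail_rec[of a i, OF a(1)] by (simp add: branch_def y_def y'_def)
  have zinv: "1 / z = b + z'" using z by (simp add: branch_def)
  define w where "w = 1 / (2 * (real N + 1))"
  have w: "0 < w" "1 / (real N + 1) = 2 * w" by (simp_all add: w_def field_simps)
  have "1 / (\<Lambda> * (N + 2)) \<le> w"
    unfolding w_def
  proof (rule divide_left_mono)
    have "2 * (real N + 1) * 1 \<le> 2 * (real N + 1) * ((real N + 1) * (N + 2))"
      by (intro mult_left_mono) (auto simp: algebra_simps)
    then show "2 * (real N + 1) \<le> \<Lambda> * (N + 2)" by (simp add: \<Lambda> power2_eq_square algebra_simps)
  qed (auto simp: \<Lambda>)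
  then have "\<bar>z - y\<bar> < w" using close unfolding y_def by (rule less_le_trans[rotated])
  then have "w < z" using y w(2) by linarith
  then have zl: "1 / (2 * (real N + 1)) \<le> z" by (simp add: w_def)
  have pos: "0 < z" "0 < y" using \<open>w < z\<close> y w by linarith+
  have key: "\<bar>1 / z - 1 / y\<bar> \<le> \<Lambda> * \<bar>z - y\<bar>"
  proof -
    have "1 / z \<le> 2 * (real N + 1)" using zl pos by (simp add: field_simps)
    moreover have "1 / y \<le> real N + 1" using y pos by (simp add: field_simps)
    moreover have L: "\<Lambda> = 2 * (real N + 1) * (real N + 1)" by (simp add: \<Lambda> power2_eq_square)
    ultimately have "1 / z * (1 / y) \<le> 2 * (real N + 1) * (real N + 1)"
      using pos by (intro mult_mono) auto
    then have "\<bar>z - y\<bar> * (1 / z * (1 / y)) \<le> \<bar>z - y\<bar> * \<Lambda>"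
      unfolding L by (rule mult_left_mono) simp
    moreover have "1 / z - 1 / y = (y - z) * (1 / z * (1 / y))" using pos by (simp add: field_simps)
    then have "\<bar>1 / z - 1 / y\<bar> = \<bar>z - y\<bar> * (1 / z * (1 / y))"
      using pos by (simp add: abs_mult abs_minus_commute)
    ultimately show ?thesis by (simp add: mult.commute)
  qed
  have "\<Lambda> * \<bar>z - y\<bar> < 1 / (real N + 2)"
  proof -
    have "0 < real N + 1" by simp
    then have "0 < \<Lambda>" by (simp add: \<Lambda>)
    then have "\<Lambda> * \<bar>z - y\<bar> < \<Lambda> * (1 / (\<Lambda> * (N + 2)))"
      using close unfolding y_def by (intro mult_strict_left_mono)
    then show ?thesis using \<open>0 < \<Lambda>\<close> by (simp add: add.commute)
  qed
  \<comment> \<open>\<open>y'\<close> has distance at least 1 / (N + 2) from 0 and 1, and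
    \<open>z'\<close> is in the unit interval, so the integer parts cannot differ.\<close>
  then have "\<bar>(b + z') - (a i + y')\<bar> < 1 / (real N + 2)" using key yinv zinv by simp
  then have "real b < real (a i) + 1" "real (a i) < real b + 1"
    using y'0 y'1 z' by (auto simp: abs_less_iff)
  then show "b = a i" by linarith
  then show "\<bar>z' - tail a (Suc i)\<bar> \<le> \<Lambda> * \<bar>z - tail a i\<bar>" using key yinv zinv by (simp add: y_def y'_def)
qed

context cost_function
begin

text \<open>A competing orbit is cut into runs shadowing \<open>S\<close> and single excursions away from it. Along a
  run the Birkhoff sum telescopes up to a bounded error, which is outweighed by the penalty paid at the
  excursion ending the run. During the last \<open>q\<close> steps of a run, where the distances are not small
  compared with \<open>D\<close>, the error is bounded by the total cost of \<open>S\<close> instead.\<close>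

lemma locking:
  fixes q N :: nat
  assumes p: "periodic a n" and N: "\<And>i. a i \<le> N" and D: "0 < D" "D \<le> 1 / (real N + 2)"
    and gap: "\<And>i l. 0 < l \<Longrightarrow> l < n \<Longrightarrow> D \<le> \<bar>tail a i - tail a (i + l)\<bar>"
    and S: "S = tail a ` {..<n}"
    and h: "hoelder \<alpha> \<epsilon> h" "\<And>x. x \<in> {0..1} \<Longrightarrow> \<bar>h x\<bar> \<le> \<delta>"
    and \<Lambda>: "\<Lambda> = 2 * (real N + 1)\<^sup>2"
    and small: "(q + 2) * cost a n + B * (distortion \<alpha> * ((1 / 2) ^ q * D) powr \<alpha>) + (2 * real n + 2) * \<delta>
      \<le> \<epsilon> * (D / (4 * \<Lambda>)) powr \<alpha>"
    and \<beta>: "n * \<beta> = (\<Sum>i<n. h (tail a i)) - cost a n"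
    and pb: "periodic b m"
  shows "(\<Sum>j<m. h (tail b j) - c (b j) (tail b (Suc j)) - \<epsilon> * infdist (tail b j) S powr \<alpha>) \<le> m * \<beta>"
proof -
  \<comment> \<open>One step expands a distance below \<kappa> to at most D / 4, so the orbit point
    to be followed cannot be confused with another one.\<close>
  define y z \<kappa> where "y = tail a" and "z = tail b" and "\<kappa> = D / (4 * \<Lambda>)"
  have n: "0 < n" using p by (simp add: periodic_def)
  have age: "1 \<le> a i" for i using periodic_ge_1[OF p] .
  have bge: "1 \<le> b i" for i using periodic_ge_1[OF pb] .
  have yu: "y i \<in> {0..1}" for i using tail_unit[of a, OF age] by (simp add: y_def)
  have zu: "z i \<in> {0..1}" for i using tail_unit[of b, OF bge] by (simp add: z_def)
  have \<Lambda>2: "2 \<le> \<Lambda>"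
  proof -
    have "1 \<le> (real N + 1)\<^sup>2" by (rule one_le_power) simp
    then show ?thesis by (simp add: \<Lambda>)
  qed
  have \<kappa>: "0 < \<kappa>" "\<kappa> \<le> D / 4" "\<Lambda> * \<kappa> = D / 4"
  proof -
    show "0 < \<kappa>" using D \<Lambda>2 by (simp add: \<kappa>_def)
    show "\<Lambda> * \<kappa> = D / 4" using \<Lambda>2 by (simp add: \<kappa>_def)
    have "D / (4 * \<Lambda>) \<le> D / 4" using D \<Lambda>2 by (intro divide_left_mono) auto
    then show "\<kappa> \<le> D / 4" by (simp add: \<kappa>_def)
  qed
  have \<epsilon>: "0 \<le> \<epsilon>" using hoelder_nonneg[OF h(1)] .
  have \<delta>: "0 \<le> \<delta>" using h(2)[of 0] by (simp add: order.trans[OF abs_ge_zero])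
  have cost: "0 \<le> cost a n" by (rule cost_nonneg[OF p])
  have per: "y (k + r * n) = y k" for k r
    using periodic_tail_mult[OF p] by (simp add: y_def)
  have eq: "y i = y i'" if "\<bar>y i - y i'\<bar> < D" for i i'
  proof -
    have le: "y i = y i'" if "i \<le> i'" "\<bar>y i - y i'\<bar> < D" for i i'
    proof -
      define l where "l = (i' - i) mod n"
      have "i' = (i + l) + ((i' - i) div n) * n" using that(1) by (simp add: l_def)
      then have e: "y i' = y (i + l)" using per by metis
      have "l < n" using n by (simp add: l_def)
      then have "l = 0" using gap[of l i] that(2) e by (fastforce simp: y_def)
      then show ?thesis using e by simp
    qed
    show ?thesis
    proof (cases "i \<le> i'")
      case True then show ?thesis using le that by blast
    next
      case False then show ?thesis using le[of i' i] that by (simp add: abs_minus_commute)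
    qed
  qed
  define d where "d j = infdist (z j) S" for j
  have attained: "\<exists>i. d j = \<bar>z j - y i\<bar>" for j
  proof -
    have "finite S" "S \<noteq> {}" using n by (auto simp: S lessThan_empty_iff)
    then obtain w where "w \<in> S" "infdist (z j) S = dist (z j) w"
      using infdist_attains_inf[OF finite_imp_closed] by metis
    then show ?thesis by (auto simp: d_def S y_def dist_real_def)
  qed
  have d_nonneg: "0 \<le> d j" for j by (simp add: d_def infdist_nonneg)
  have d_eq: "d j = \<bar>z j - y i\<bar>" if "\<bar>z j - y i\<bar> < \<kappa>" for i j
  proof -
    obtain i' where i': "d j = \<bar>z j - y i'\<bar>" using attained by blast
    have "y i \<in> S"
    proof -
      have "y i = y (i mod n)" using per[of "i mod n" "i div n"] by simp
      then show ?thesis using n by (simp add: S y_def)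
    qed
    then have "d j \<le> \<bar>z j - y i\<bar>" unfolding d_def dist_real_def[symmetric] by (rule infdist_le)
    then have "\<bar>y i - y i'\<bar> < D" using i' that \<kappa> D by linarith
    then show ?thesis using eq[of i i'] i' by simp
  qed
  define close where "close j \<longleftrightarrow> (\<exists>i. \<bar>z j - y i\<bar> < \<kappa>)" for j
  have step: "b j = a i" "\<bar>z (Suc j) - y (Suc i)\<bar> \<le> D / 4" if "\<bar>z j - y i\<bar> < \<kappa>" for i j
  proof -
    have "D < 4 / (real N + 2)" using D by (simp add: field_simps)
    then have "D / (4 * \<Lambda>) < 4 / (real N + 2) / (4 * \<Lambda>)" using \<Lambda>2 by (intro divide_strict_right_mono) auto
    also have "\<dots> = 1 / (\<Lambda> * (N + 2))" by simp
    finally have lt: "\<bar>z j - tail a i\<bar> < 1 / (\<Lambda> * (N + 2))" using that by (simp add: \<kappa>_def y_def)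
    have zj: "z j = branch (b j) (z (Suc j))" unfolding z_def by (rule tail_rec[of b, OF bge])
    note nd = nearby_digit[of a N, OF age N bge zu zj \<Lambda> lt]
    show "b j = a i" by (rule nd(1))
    have "\<bar>z (Suc j) - y (Suc i)\<bar> \<le> \<Lambda> * \<bar>z j - y i\<bar>" using nd(2) by (simp add: y_def)
    also have "\<dots> \<le> \<Lambda> * \<kappa>" using that \<Lambda>2 by (intro mult_left_mono) auto
    finally show "\<bar>z (Suc j) - y (Suc i)\<bar> \<le> D / 4" using \<kappa> by simp
  qed
  \<comment> \<open>After a step the point is within D / 4 of the image of the shadowed point and,
    being close, within \<kappa> of some orbit point. These two are less than D apart, hence
    equal.\<close>
  have shadow: "\<bar>z (j + s) - y (i + s)\<bar> < \<kappa>"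
    if start: "\<bar>z j - y i\<bar> < \<kappa>" and run: "\<And>s. s < L \<Longrightarrow> close (j + s)" and "s < L" for i j s L
    using \<open>s < L\<close>
  proof (induction s)
    case (Suc s)
    then have "\<bar>z (j + Suc s) - y (i + Suc s)\<bar> \<le> D / 4" using step(2)[of "j + s" "i + s"] by simp
    moreover obtain i' where i': "\<bar>z (j + Suc s) - y i'\<bar> < \<kappa>"
      using run[OF Suc.prems] unfolding close_def by blast
    ultimately have "\<bar>y (i + Suc s) - y i'\<bar> < D" using \<kappa> D by linarith
    then show ?case using eq i' by metis
  qed (use start in simp)
  define F where "F i = h (y i) - c (a i) (y (Suc i)) - \<beta>" for i
  define G where "G j = h (z j) - c (b j) (z (Suc j)) - \<epsilon> * d j powr \<alpha> - \<beta>" for j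
  define T where "T = B * (distortion \<alpha> * ((1 / 2) ^ q * D) powr \<alpha>)"
  \<comment> \<open>The largest possible gain of a run: \<open>T\<close> for its early part,
    \<open>q\<close> times the cost for its last \<open>q\<close> steps, and one cost plus 2 n
    \<delta> for an incomplete period of \<open>F\<close>.\<close>
  define R where "R = (q + 1) * cost a n + T + 2 * n * \<delta>"
  have T: "0 \<le> T" using B_nonneg distortion_pos[OF alpha(1)] by (simp add: T_def)
  have R: "0 \<le> R" using cost T \<delta> by (simp add: R_def)
  have \<beta>_ge: "- \<beta> \<le> \<delta> + cost a n / n"
  proof -
    have "- (n * \<delta>) \<le> (\<Sum>i<n. h (tail a i))"
    proof -
      have "- \<delta> \<le> h (tail a i)" for i using h(2)[OF yu[of i]] by (simp add: y_def)
      then show ?thesis using sum_bounded_below[of "{..<n}" "- \<delta>" "\<lambda>i. h (tail a i)"] by simp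
    qed
    then have "n * (- \<beta>) \<le> n * (\<delta> + cost a n / n)" using \<beta> n by (simp add: algebra_simps)
    then show ?thesis by (rule mult_left_le_imp_le) (use n in simp)
  qed
  have cost_n: "cost a n / n \<le> cost a n" using cost n by (simp add: divide_le_eq mult_le_cancel_left1)
  \<comment> \<open>The hypothesis \<open>small\<close> pays for R + cost + 2 \<delta>; the excess
    over \<open>R\<close> absorbs \<open>h\<close> and - \<beta>.\<close>
  have far: "G j \<le> - R" if "\<not> close j" for j
  proof -
    have "\<kappa> \<le> d j" using attained[of j] that unfolding close_def by (metis not_less)
    then have "\<epsilon> * \<kappa> powr \<alpha> \<le> \<epsilon> * d j powr \<alpha>" using \<epsilon> \<kappa> alpha by (intro mult_left_mono powr_mono2) auto
    moreover have "h (z j) \<le> \<delta>" using h(2)[OF zu[of j]] by simp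
    moreover have "0 \<le> c (b j) (z (Suc j))" using c_nonneg[OF bge zu] .
    moreover have "R + cost a n + 2 * \<delta> \<le> \<epsilon> * \<kappa> powr \<alpha>"
      using small by (simp add: R_def T_def \<kappa>_def algebra_simps)
    ultimately show ?thesis using \<beta>_ge cost_n unfolding G_def by linarith
  qed
  have F_sum: "(\<Sum>s<L. F (i + s)) \<le> n * (2 * \<delta> + cost a n / n)" for i L
  proof (rule periodic_partial_sum_le[OF n])
    show "F (i + n) = F i" for i
      using periodic_tail[OF p, of i] periodic_tail[OF p, of "Suc i"] p
      by (simp add: F_def y_def periodic_def)
    show "(\<Sum>i<n. F i) = 0"
      using \<beta> by (simp add: F_def sum_subtractf cost_def y_def)
    show "F i \<le> 2 * \<delta> + cost a n / n" for i
      using h(2)[OF yu[of i]] c_nonneg[OF age yu, of i "Suc i"] \<beta>_ge unfolding F_def by linarith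
    show "0 \<le> 2 * \<delta> + cost a n / n" using \<delta> cost by simp
  qed
  have run: "(\<Sum>s<L. G (j + s)) \<le> R" if "close j" and cl: "\<And>s. s < L \<Longrightarrow> close (j + s)" for j L
  proof -
    obtain i where i: "\<bar>z j - y i\<bar> < \<kappa>" using \<open>close j\<close> unfolding close_def by blast
    have sh: "\<bar>z (j + s) - y (i + s)\<bar> < \<kappa>" if "s < L" for s
      by (rule shadow[where L=L, OF i]) (use cl that in auto)
    define K r where "K = L - q" and "r = L - K"
    have L: "L = K + r" "r \<le> q" by (auto simp: K_def r_def)
    \<comment> \<open>The penalty compensates the Hoelder variation of \<open>h\<close> exactly,
      since on a run the distance to \<open>S\<close> is the distance to the shadowed point.\<close>
    have hz: "h (z (j + s)) - \<epsilon> * d (j + s) powr \<alpha> \<le> h (y (i + s))" if "s < L" for s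
      using hoelderD[OF h(1) zu[of "j + s"] yu[of "i + s"]] d_eq[OF sh[OF that]] by simp
    have dig: "b (j + s) = a (i + s)" if "s < L" for s using step(1)[OF sh[OF that]] .
    have late: "G (j + s) \<le> F (i + s) + cost a n" if "s < L" for s
      using hz[OF that] c_nonneg[OF bge zu, of "j + s" "Suc (j + s)"] cost_term_le[OF p, of "i + s"]
      unfolding G_def F_def y_def by linarith
    have early: "G (j + s) \<le> F (i + s) + B * \<bar>z (Suc (j + s)) - y (Suc (i + s))\<bar> powr \<alpha>" if "s < L" for s
      using hz[OF that] hoelderD[OF c_hoelder[OF age[of "i + s"]] zu[of "Suc (j + s)"] yu[of "Suc (i + s)"]]
      unfolding G_def F_def dig[OF that] by linarith
    have B_sum: "(\<Sum>s<K. B * \<bar>z (Suc (j + s)) - y (Suc (i + s))\<bar> powr \<alpha>) \<le> T"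
    proof (cases "K = 0")
      case False
      have chy: "chain (\<lambda>s. a (i + s)) (\<lambda>s. y (i + s)) L" unfolding y_def by (rule chain_tail[of a, OF age])
      have "chain (\<lambda>s. b (j + s)) (\<lambda>s. z (j + s)) L" unfolding z_def by (rule chain_tail[of b, OF bge])
      then have chz: "chain (\<lambda>s. a (i + s)) (\<lambda>s. z (j + s)) L" by (rule chain_cong) (simp add: dig)
      have sub: "chain \<xi> w L \<Longrightarrow> chain \<xi> w K" for \<xi> w by (auto simp: chain_def L)
      \<comment> \<open>The point following the run is still within D / 4 of its companion;
        \<open>q\<close> steps earlier the distance has shrunk to at most D / 2 ^ q.\<close>
      have "L = Suc (L - 1)" using False by (simp add: K_def)
      then have last: "\<bar>z (j + L) - y (i + L)\<bar> \<le> D / 4"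
        using step(2)[OF sh[of "L - 1"]] by (metis add_Suc_right lessI)
      have "\<bar>z (j + K) - y (i + K)\<bar> \<le> 4 * (1 / 2) ^ (L - K) * \<bar>z (j + L) - y (i + L)\<bar>"
        using chain_contract[OF chz chy, of K] L by simp
      also have "L - K = q" using False by (simp add: K_def)
      also have "4 * (1 / 2) ^ q * \<bar>z (j + L) - y (i + L)\<bar> \<le> 4 * (1 / 2) ^ q * (D / 4)"
        using last by (rule mult_left_mono) simp
      finally have "\<bar>z (j + K) - y (i + K)\<bar> powr \<alpha> \<le> ((1 / 2) ^ q * D) powr \<alpha>"
        using alpha by (intro powr_mono2) auto
      then have "distortion \<alpha> * \<bar>z (j + K) - y (i + K)\<bar> powr \<alpha> \<le> distortion \<alpha> * ((1 / 2) ^ q * D) powr \<alpha>"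
        using distortion_pos[OF alpha(1)] by (intro mult_left_mono) auto
      then have "(\<Sum>s<K. \<bar>z (j + Suc s) - y (i + Suc s)\<bar> powr \<alpha>) \<le> distortion \<alpha> * ((1 / 2) ^ q * D) powr \<alpha>"
        using chain_sum_powr(2)[OF alpha(1) sub[OF chz] sub[OF chy]] by linarith
      then show ?thesis
        using B_nonneg by (simp add: T_def mult_left_mono flip: sum_distrib_left)
    qed (use T in simp)
    have "(\<Sum>s<L. G (j + s)) = (\<Sum>s<K. G (j + s)) + (\<Sum>s<r. G (j + (K + s)))"
      unfolding L(1) by (rule sum_lessThan_plus)
    also have "(\<Sum>s<K. G (j + s)) \<le> (\<Sum>s<K. F (i + s) + B * \<bar>z (Suc (j + s)) - y (Suc (i + s))\<bar> powr \<alpha>)"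
      using early L by (intro sum_mono) simp
    also have "(\<Sum>s<r. G (j + (K + s))) \<le> (\<Sum>s<r. F (i + (K + s)) + cost a n)"
      using late L by (intro sum_mono) simp
    also have "(\<Sum>s<K. F (i + s) + B * \<bar>z (Suc (j + s)) - y (Suc (i + s))\<bar> powr \<alpha>) + (\<Sum>s<r. F (i + (K + s)) + cost a n)
      = (\<Sum>s<L. F (i + s)) + (\<Sum>s<K. B * \<bar>z (Suc (j + s)) - y (Suc (i + s))\<bar> powr \<alpha>) + r * cost a n"
      unfolding L(1) sum_lessThan_plus[of "\<lambda>s. F (i + s)"] by (simp add: sum.distrib)
    also have "\<dots> \<le> n * (2 * \<delta> + cost a n / n) + T + q * cost a n"
      using F_sum B_sum L(2) cost by (intro add_mono mult_right_mono) auto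
    also have "\<dots> = R" using n by (simp add: R_def algebra_simps)
    finally show ?thesis by simp
  qed
  \<comment> \<open>Cut at the first excursion: the run before it gains at most \<open>R\<close> and
    the excursion loses at least \<open>R\<close>, so the bound starts afresh.\<close>
  have total: "(\<Sum>s<t. G (j + s)) \<le> R" for t j
  proof (induction t arbitrary: j rule: less_induct)
    case (less t)
    show ?case
    proof (cases "\<forall>s<t. close (j + s)")
      case True
      then show ?thesis using run[of j t] R by (cases "t = 0") auto
    next
      case False
      define L where "L = (LEAST s. s < t \<and> \<not> close (j + s))"
      have L: "L < t" "\<not> close (j + L)"
        using LeastI_ex[of "\<lambda>s. s < t \<and> \<not> close (j + s)"] False unfolding L_def by blast+
      have before: "close (j + s)" if "s < L" for s
        using not_less_Least[of s "\<lambda>s. s < t \<and> \<not> close (j + s)"] that L(1) unfolding L_def[symmetric] by force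
      have first: "(\<Sum>s<L. G (j + s)) \<le> R"
        using run[of j L] before[of 0] before R by (cases "L = 0") simp_all
      have t: "t = Suc L + (t - Suc L)" using L(1) by simp
      have "(\<Sum>s<t. G (j + s)) = (\<Sum>s<Suc L. G (j + s)) + (\<Sum>s<t - Suc L. G (j + (Suc L + s)))"
        by (subst t, rule sum_lessThan_plus)
      also have "\<dots> = (\<Sum>s<L. G (j + s)) + G (j + L) + (\<Sum>s<t - Suc L. G (j + Suc L + s))"
        by (simp add: add.assoc)
      also have "\<dots> \<le> R"
        using first far[OF L(2)] less.IH[of "t - Suc L" "j + Suc L"] L(1) by linarith
      finally show ?thesis .
    qed
  qed
  have G_per: "G (j + m) = G j" for j
    using periodic_tail[OF pb, of j] periodic_tail[OF pb, of "Suc j"] pb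
    by (simp add: G_def z_def d_def periodic_def)
  \<comment> \<open>A positive sum over one period would make the sums over many periods exceed
    \<open>R\<close>.\<close>
  have "(\<Sum>j<m. G j) \<le> 0"
  proof (rule ccontr)
    assume "\<not> ?thesis"
    then obtain k :: nat where "R < k * (\<Sum>j<m. G j)"
      using reals_Archimedean3[of "\<Sum>j<m. G j"] by (auto simp: not_le)
    then show False using total[where j=0 and t="k * m"] sum_periods[of G m k, OF G_per] by simp
  qed
  then show ?thesis by (simp add: G_def d_def z_def sum_subtractf)
qed

end

section \<open>The set of contact and the perturbation\<close>

lemma branch_contract:
  assumes "1 \<le> k" "x \<in> {0..1}" "y \<in> {0..1}"
  shows "\<bar>branch k x - branch k y\<bar> \<le> \<bar>x - y\<bar>"
proof -
  have k: "1 \<le> real k + x" "1 \<le> real k + y" using assms by auto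
  define P where "P = (real k + x) * (real k + y)"
  have "1 * 1 \<le> P" unfolding P_def using k by (intro mult_mono) auto
  moreover have "branch k x - branch k y = (y - x) / P"
    using k by (simp add: branch_def P_def field_simps)
  ultimately show ?thesis
    by (simp add: abs_minus_commute divide_le_eq mult_le_cancel_left1)
qed

lemma hoelder_branch:
  assumes "0 < \<alpha>" "hoelder \<alpha> H f" "1 \<le> k"
  shows "hoelder \<alpha> H (\<lambda>x. f (branch k x))"
  unfolding hoelder_def
proof (intro ballI)
  fix x y :: real assume xy: "x \<in> {0..1}" "y \<in> {0..1}"
  have "\<bar>f (branch k x) - f (branch k y)\<bar> \<le> H * \<bar>branch k x - branch k y\<bar> powr \<alpha>"
    by (rule hoelderD[OF assms(2) branch_unit'[OF assms(3) xy(1)] branch_unit'[OF assms(3) xy(2)]])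
  also have "\<dots> \<le> H * \<bar>x - y\<bar> powr \<alpha>"
    using branch_contract[OF assms(3) xy] assms(1,3) hoelder_nonneg[OF assms(2)]
    by (intro mult_left_mono powr_mono2) auto
  finally show "\<bar>f (branch k x) - f (branch k y)\<bar> \<le> H * \<bar>x - y\<bar> powr \<alpha>" .
qed

lemma hoelder_infdist_powr:
  assumes "0 < \<alpha>" "\<alpha> \<le> 1"
  shows "hoelder \<alpha> 1 (\<lambda>x. infdist x S powr \<alpha>)"
  unfolding hoelder_def
proof (intro ballI)
  have le: "infdist x S powr \<alpha> \<le> infdist y S powr \<alpha> + \<bar>x - y\<bar> powr \<alpha>" for x y :: real
  proof -
    have "infdist x S \<le> infdist y S + \<bar>x - y\<bar>" using infdist_triangle[of x S y] by (simp add: dist_real_def)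
    then have "infdist x S powr \<alpha> \<le> (infdist y S + \<bar>x - y\<bar>) powr \<alpha>"
      using assms infdist_nonneg by (intro powr_mono2) auto
    also have "\<dots> \<le> infdist y S powr \<alpha> + \<bar>x - y\<bar> powr \<alpha>"
      using assms infdist_nonneg by (intro powr_add_le) auto
    finally show ?thesis .
  qed
  show "\<bar>infdist x S powr \<alpha> - infdist y S powr \<alpha>\<bar> \<le> 1 * \<bar>x - y\<bar> powr \<alpha>" for x y :: real
    using le[of x y] le[of y x] by (simp add: abs_minus_commute abs_le_iff)
qed

section \<open>Hoelder norm estimates\<close>

lemma holder_norm_le:
  assumes "\<And>x. x \<in> {0..1} \<Longrightarrow> \<bar>g x\<bar> \<le> A" "hoelder \<alpha> C g"
  shows "holder_norm \<alpha> g \<le> A + C"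
  unfolding holder_norm_def
proof (rule add_mono)
  show "(SUP x\<in>{0..1}. \<bar>g x\<bar>) \<le> A" using assms(1) by (intro cSUP_least) auto
  let ?D = "{(x, y). x \<in> {0..1::real} \<and> y \<in> {0..1} \<and> x \<noteq> y}"
  have "(0, 1) \<in> ?D" by simp
  then have "?D \<noteq> {}" by blast
  then show "(SUP (x, y)\<in>?D. \<bar>g x - g y\<bar> / \<bar>x - y\<bar> powr \<alpha>) \<le> C"
    using hoelderD[OF assms(2)] by (intro cSUP_least) (auto simp: divide_le_eq)
qed

lemma holder_spaceD: "f \<in> holder_space \<alpha> \<Longrightarrow> \<exists>H. hoelder \<alpha> H f"
  by (auto simp: holder_space_def hoelder_def)

lemma holder_dist_bounds:
  assumes "0 < \<alpha>" "f \<in> holder_space \<alpha>" "g \<in> holder_space \<alpha>" "holder_dist \<alpha> f g \<le> \<rho>"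
  shows "x \<in> {0..1} \<Longrightarrow> \<bar>g x - f x\<bar> \<le> \<rho>" "hoelder \<alpha> \<rho> (\<lambda>x. g x - f x)"
proof -
  let ?D = "{(x, y). x \<in> {0..1::real} \<and> y \<in> {0..1} \<and> x \<noteq> y}"
  let ?h = "\<lambda>x. f x - g x"
  obtain C where C: "\<And>x y. x \<in> {0..1} \<Longrightarrow> y \<in> {0..1} \<Longrightarrow> \<bar>?h x - ?h y\<bar> \<le> C * \<bar>x - y\<bar> powr \<alpha>"
    using holder_space_diff[OF assms(2,3)] by blast
  note bdd = holder_bounds[OF assms(1), of ?h C, OF C]
  have le: "holder_norm \<alpha> ?h \<le> \<rho>" using assms by (simp add: holder_dist_def)
  show "x \<in> {0..1} \<Longrightarrow> \<bar>g x - f x\<bar> \<le> \<rho>"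
    using holder_norm_upper[of ?h \<alpha> x, OF bdd] le by (simp add: abs_minus_commute)
  have sup0: "0 \<le> (SUP x\<in>{0..1}. \<bar>?h x\<bar>)"
    by (rule cSUP_upper2[OF bdd(1), of 0]) auto
  show "hoelder \<alpha> \<rho> (\<lambda>x. g x - f x)"
    unfolding hoelder_def
  proof (intro ballI)
    fix x y :: real assume xy: "x \<in> {0..1}" "y \<in> {0..1}"
    show "\<bar>g x - f x - (g y - f y)\<bar> \<le> \<rho> * \<bar>x - y\<bar> powr \<alpha>"
    proof (cases "x = y")
      case False
      then have "(x, y) \<in> ?D" using xy by simp
      from cSUP_upper[OF this bdd(2)] have "\<bar>?h x - ?h y\<bar> / \<bar>x - y\<bar> powr \<alpha> \<le> \<rho>"
        using sup0 le by (simp add: holder_norm_def)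
      then have "\<bar>?h x - ?h y\<bar> \<le> \<rho> * \<bar>x - y\<bar> powr \<alpha>" using False by (simp add: divide_le_eq)
      moreover have "\<bar>?h x - ?h y\<bar> = \<bar>g x - f x - (g y - f y)\<bar>" by linarith
      ultimately show ?thesis by simp
    qed simp
  qed
qed

text \<open>The surplus \<open>w\<close> in the inequality forces uniqueness: a maximizing measure
  must give \<open>w\<close> integral 0, so it lives on the zero set of \<open>w\<close>, a single
  orbit.\<close>

lemma penalized_maximizing_iff:
  fixes \<beta> :: real
  assumes \<alpha>: "0 < \<alpha>" and f: "hoelder \<alpha> H f" and w: "hoelder \<alpha> K w"
    and w_nonneg: "\<And>x. x \<in> {0..1} \<Longrightarrow> 0 \<le> w x"
    and w_zero: "\<And>x. x \<in> {0..1} \<Longrightarrow> w x = 0 \<longleftrightarrow> x \<in> tail a ` {..<n}"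
    and p: "periodic a n" and inj: "inj_on (tail a) {..<n}"
    and per: "\<And>b m. periodic b m \<Longrightarrow> (\<Sum>j<m. f (tail b j) + w (tail b j)) \<le> m * \<beta>"
    and \<beta>: "(\<Sum>i<n. f (tail a i)) = n * \<beta>"
  shows "maximizing f \<mu> \<longleftrightarrow> \<mu> = per_measure a n"
proof -
  have le: "(\<integral>x. f x \<partial>\<nu>) + (\<integral>x. w x \<partial>\<nu>) \<le> \<beta>" if \<nu>: "\<nu> \<in> invariant_measures" for \<nu>
    using invariant_integral_le[OF \<alpha> hoelder_add[OF f w] per \<nu>] hoelder_integrable[OF \<alpha> f \<nu>]
      hoelder_integrable[OF \<alpha> w \<nu>] by simp
  have w_int: "0 \<le> (\<integral>x. w x \<partial>\<nu>)" if \<nu>: "\<nu> \<in> invariant_measures" for \<nu>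
    using w_nonneg invariant_measureD(3)[OF \<nu>] by (intro Bochner_Integration.integral_nonneg_AE AE_I2) auto
  have n: "0 < n" using p by (simp add: periodic_def)
  note pi = per_measure_invariant[OF p]
  have pint: "(\<integral>x. f x \<partial>per_measure a n) = \<beta>"
    using integral_per_measure[OF \<alpha> f p] \<beta> n by simp
  have max: "max_integral f = \<beta>"
  proof (rule antisym)
    show "max_integral f \<le> \<beta>"
      unfolding max_integral_def
    proof (rule cSUP_least)
      show "(\<integral>x. f x \<partial>\<nu>) \<le> \<beta>" if "\<nu> \<in> invariant_measures" for \<nu>
        using le[OF that] w_int[OF that] by linarith
    qed (use pi in blast)
    show "\<beta> \<le> max_integral f" using max_integral_upper[OF \<alpha> f pi] pint by simp
  qed
  show ?thesis
  proof
    assume "maximizing f \<mu>"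
    then have \<mu>: "\<mu> \<in> invariant_measures" "(\<integral>x. f x \<partial>\<mu>) = \<beta>" by (auto simp: maximizing_def max)
    then have "(\<integral>x. w x \<partial>\<mu>) = 0" using le[OF \<mu>(1)] w_int[OF \<mu>(1)] by simp
    moreover have "AE x in \<mu>. 0 \<le> w x"
      using w_nonneg invariant_measureD(3)[OF \<mu>(1)] by (intro AE_I2) simp
    ultimately have "AE x in \<mu>. w x = 0"
      using integral_nonneg_eq_0_iff_AE[OF hoelder_integrable[OF \<alpha> w \<mu>(1)]] by simp
    then have "AE x in \<mu>. x \<in> tail a ` {..<n}"
      using AE_space by eventually_elim (use w_zero invariant_measureD(3)[OF \<mu>(1)] in blast)
    then show "\<mu> = per_measure a n" by (rule invariant_on_orbit_unique[OF p inj \<mu>(1)])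
  next
    assume "\<mu> = per_measure a n"
    then show "maximizing f \<mu>" using pi pint max by (simp add: maximizing_def)
  qed
qed

text \<open>The defect is nonnegative with integral 0, hence vanishes almost everywhere. Invariance
  passes this, and the avoidance of a neighbourhood of 0, to all iterates of almost every point;
  staying away from 0 bounds the digits.\<close>

lemma contact_orbit_exists:
  assumes \<alpha>: "0 < \<alpha>" and f: "hoelder \<alpha> H f" and u: "hoelder \<alpha> K u"
    and rev: "\<And>k x. 1 \<le> k \<Longrightarrow> x \<in> {0..1} \<Longrightarrow> f (branch k x) - max_integral f + u (branch k x) \<le> u x"
    and \<mu>: "maximizing f \<mu>" "0 \<notin> measure_support \<mu>"
  obtains a x where "finite (range a)" "\<And>i. 1 \<le> a i" "\<And>i. x i \<in> {0..1}"
    "\<And>i. x i = branch (a i) (x (Suc i))"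
    "\<And>i. u (x (Suc i)) = f (branch (a i) (x (Suc i))) - max_integral f + u (branch (a i) (x (Suc i)))"
proof -
  let ?Q = "max_integral f"
  have inv: "\<mu> \<in> invariant_measures" and int: "(\<integral>x. f x \<partial>\<mu>) = ?Q" using \<mu>(1) by (auto simp: maximizing_def)
  note i = invariant_measureD[OF inv]
  interpret prob_space \<mu> by (rule i(1))
  define g where "g x = u (gauss_map x) - (f x - ?Q + u x)" for x
  have f0: "f 0 \<le> ?Q" using value_0_le[OF \<alpha> f] periodic_sum_le_max[OF \<alpha> f] by blast
  have g0: "0 \<le> g x" if "x \<in> {0..1}" for x
    using revealed_le[of f ?Q u x, OF f0 rev that] by (simp add: g_def)
  note intf = hoelder_integrable[OF \<alpha> f inv] and intu = hoelder_integrable[OF \<alpha> u inv]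
  note intug = integral_gauss[OF inv intu]
  have "integrable \<mu> g" unfolding g_def using intf intu intug(1) by simp
  moreover have "(\<integral>x. g x \<partial>\<mu>) = 0"
    unfolding g_def using intf intu intug int by (simp add: prob_space)
  moreover have "AE x in \<mu>. 0 \<le> g x" using g0 i(3) by (intro AE_I2) simp
  ultimately have ae_g: "AE x in \<mu>. g x = 0" using integral_nonneg_eq_0_iff_AE[of \<mu> g] by simp
  obtain V where V: "open V" "0 \<in> V" "\<not> 0 < emeasure \<mu> (V \<inter> space \<mu>)"
    using \<mu>(2) i(3) by (auto simp: measure_support_def)
  obtain \<delta> where \<delta>: "0 < \<delta>" "ball 0 \<delta> \<subseteq> V" using V openE by blast
  have "V \<inter> space \<mu> \<in> sets \<mu>" using V(1) i(2,3) by (auto simp: sets_restrict_space_iff)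
  then have null: "V \<inter> space \<mu> \<in> null_sets \<mu>" using V(3) by (auto simp: null_sets_def)
  have ae_\<delta>: "AE x in \<mu>. \<delta> \<le> x"
    using AE_not_in[OF null] AE_space
  proof eventually_elim
    case (elim x)
    then have "x \<notin> ball 0 \<delta>" using \<delta>(2) by blast
    moreover have "0 \<le> x" using elim(2) i(3) by simp
    ultimately show ?case by (simp add: dist_real_def)
  qed
  define P where "P x \<longleftrightarrow> \<delta> \<le> x \<and> g x = 0" for x
  have "AE x in \<mu>. P ((gauss_map ^^ k) x)" for k
  proof (induction k)
    case 0
    then show ?case using ae_g ae_\<delta> by (simp add: P_def)
  next
    case (Suc k)
    have "AE x in distr \<mu> \<mu> gauss_map. P ((gauss_map ^^ k) x)" unfolding i(5) by (rule Suc)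
    from AE_distrD[OF i(4) this] show ?case by (simp add: funpow_swap1)
  qed
  then have "AE x in \<mu>. \<forall>k. P ((gauss_map ^^ k) x)" by (simp add: AE_all_countable)
  then have ae: "AE x in \<mu>. x \<in> space \<mu> \<and> (\<forall>k. P ((gauss_map ^^ k) x))" using AE_space by eventually_elim simp
  have "\<exists>x. x \<in> space \<mu> \<and> (\<forall>k. P ((gauss_map ^^ k) x))"
  proof (rule ccontr)
    assume none: "\<not> ?thesis"
    have "AE x in \<mu>. False" using ae by (rule eventually_mono) (use none in blast)
    then show False by simp
  qed
  then obtain x0 where x0: "x0 \<in> space \<mu>" "\<And>k. P ((gauss_map ^^ k) x0)" by blast
  define x where "x k = (gauss_map ^^ k) x0" for k
  define a where "a k = nat \<lfloor>1 / x k\<rfloor>" for k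
  have xu: "x k \<in> {0..1}" for k
    by (induction k) (use x0(1) i(3) gauss_map_unit in \<open>auto simp: x_def simp del: atLeastAtMost_iff\<close>)
  have x\<delta>: "\<delta> \<le> x k" and gx: "g (x k) = 0" for k using x0(2)[of k] by (auto simp: P_def x_def)
  have x01: "x k \<in> {0<..1}" for k using xu[of k] x\<delta>[of k] \<delta>(1) by auto
  have suc: "x (Suc k) = gauss_map (x k)" for k by (simp add: x_def)
  have eq: "branch (a k) (x (Suc k)) = x k" for k unfolding suc a_def by (rule branch_gauss(2)[OF x01])
  show thesis
  proof (rule that[of a x])
    have "a k \<le> nat \<lfloor>1 / \<delta>\<rfloor>" for k
      unfolding a_def using x\<delta>[of k] \<delta>(1) by (intro nat_mono floor_mono divide_left_mono) (auto intro: mult_pos_pos)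
    then have "range a \<subseteq> {..nat \<lfloor>1 / \<delta>\<rfloor>}" by auto
    then show "finite (range a)" by (rule finite_subset) simp
    show "1 \<le> a k" for k unfolding a_def by (rule branch_gauss(1)[OF x01])
    show "x k \<in> {0..1}" for k by (rule xu)
    show "x k = branch (a k) (x (Suc k))" for k using eq by simp
    show "u (x (Suc k)) = f (branch (a k) (x (Suc k))) - ?Q + u (branch (a k) (x (Suc k)))" for k
      unfolding eq using gx[of k] by (simp add: g_def suc)
  qed
qed

lemma hoelder_restrict: "hoelder \<alpha> H (restrict f {0..1}) = hoelder \<alpha> H f"
  by (simp add: hoelder_def)

text \<open>The cap \<open>D0\<close> supplies the upper bound required for locking, and it is the
  value of the gap when n = 1 and no pairs exist.\<close>

lemma min_gap_exists:
  assumes p: "periodic a n" and D0: "0 < D0" "E \<le> D0 powr \<alpha>" and E: "0 \<le> E"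
    and iso: "\<And>i l. 0 < l \<Longrightarrow> l < n \<Longrightarrow> E < \<bar>tail a i - tail a (i + l)\<bar> powr \<alpha>"
  obtains D where "0 < D" "D \<le> D0" "E \<le> D powr \<alpha>"
    "\<And>i l. 0 < l \<Longrightarrow> l < n \<Longrightarrow> D \<le> \<bar>tail a i - tail a (i + l)\<bar>"
proof -
  define A where "A = insert D0 ((\<lambda>(i, l). \<bar>tail a i - tail a (i + l)\<bar>) ` ({..<n} \<times> {0<..<n}))"
  have A: "finite A" "A \<noteq> {}" by (auto simp: A_def)
  have each: "0 < t \<and> E \<le> t powr \<alpha>" if t: "t \<in> A" for t
  proof -
    consider "t = D0" | i l where "0 < l" "l < n" "t = \<bar>tail a i - tail a (i + l)\<bar>"
      using t by (auto simp: A_def)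
    then show ?thesis
    proof cases
      case 2
      then have "E < t powr \<alpha>" using iso by simp
      moreover from this have "t \<noteq> 0" using E by auto
      ultimately show ?thesis using 2(3) by simp
    qed (use D0 in simp)
  qed
  have min: "Min A \<in> A" using A by (rule Min_in)
  have gap: "Min A \<le> \<bar>tail a i - tail a (i + l)\<bar>" if l: "0 < l" "l < n" for i l
  proof -
    have "tail a i = tail a (i mod n)" "tail a (i + l) = tail a (i mod n + l)"
      using periodic_tail_mult[OF p, of "i mod n" "i div n"] periodic_tail_mult[OF p, of "i mod n + l" "i div n"]
      by (simp_all add: add.commute add.left_commute)
    moreover have "\<bar>tail a (i mod n) - tail a (i mod n + l)\<bar> \<in> A"
      using l by (force simp: A_def)
    ultimately show ?thesis using A(1) by (metis Min_le)
  qed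
  have "Min A \<le> D0" using A(1) by (simp add: A_def)
  then show thesis using that[of "Min A"] each[OF min] gap by blast
qed

lemma locked_perturbation_exists:
  assumes \<alpha>: "0 < \<alpha>" "\<alpha> \<le> 1" and \<phi>: "\<phi> \<in> essentially_compact \<alpha>" and \<epsilon>: "0 < \<epsilon>"
  obtains \<psi> \<rho> where "\<psi> \<in> holder_space \<alpha>" "holder_dist \<alpha> \<phi> \<psi> < \<epsilon>" "0 < \<rho>"
    "\<And>\<xi>. \<xi> \<in> holder_space \<alpha> \<Longrightarrow> holder_dist \<alpha> \<psi> \<xi> < \<rho> \<Longrightarrow>
      periodic_optimization \<xi> \<and> \<xi> \<in> essentially_compact \<alpha>"
proof -
  have \<phi>_space: "\<phi> \<in> holder_space \<alpha>" using \<phi> by (simp add: essentially_compact_def)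
  obtain H where H: "hoelder \<alpha> H \<phi>" using holder_spaceD[OF \<phi>_space] by blast
  obtain \<mu> where \<mu>: "maximizing \<phi> \<mu>" "0 \<notin> measure_support \<mu>"
    using \<phi> by (auto simp: essentially_compact_def)
  define Q where "Q = max_integral \<phi>"
  define K where "K = distortion \<alpha> * H"
  obtain u where u: "hoelder \<alpha> K u" and
    rev: "\<And>k x. 1 \<le> k \<Longrightarrow> x \<in> {0..1} \<Longrightarrow> \<phi> (branch k x) - Q + u (branch k x) \<le> u x"
    using subaction_shift[OF \<alpha>(1) H periodic_sum_le_max[OF \<alpha>(1) H]] unfolding K_def Q_def by metis
  obtain a0 x0 where a0: "finite (range a0)" "\<And>i. 1 \<le> a0 i" and x0: "\<And>i. x0 i \<in> {0..1}"
    "\<And>i. x0 i = branch (a0 i) (x0 (Suc i))"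
    and contact: "\<And>i. u (x0 (Suc i)) = \<phi> (branch (a0 i) (x0 (Suc i))) - Q + u (branch (a0 i) (x0 (Suc i)))"
    using contact_orbit_exists[OF \<alpha>(1) H u rev[unfolded Q_def] \<mu>] unfolding Q_def by metis
  define c where "c k x = u x - (\<phi> (branch k x) - Q + u (branch k x))" for k x
  define B where "B = 2 * K + H"
  interpret cost_function \<alpha> B c
  proof
    show "hoelder \<alpha> B (c k)" if k: "1 \<le> k" for k
      unfolding hoelder_def
    proof (intro ballI)
      fix x y :: real assume xy: "x \<in> {0..1}" "y \<in> {0..1}"
      have "B * \<bar>x - y\<bar> powr \<alpha> = K * \<bar>x - y\<bar> powr \<alpha> + H * \<bar>x - y\<bar> powr \<alpha> + K * \<bar>x - y\<bar> powr \<alpha>"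
        by (simp add: B_def algebra_simps)
      then show "\<bar>c k x - c k y\<bar> \<le> B * \<bar>x - y\<bar> powr \<alpha>"
        using hoelderD[OF u xy] hoelderD[OF hoelder_branch[OF \<alpha>(1) H k] xy]
          hoelderD[OF hoelder_branch[OF \<alpha>(1) u k] xy] unfolding c_def by linarith
    qed
  qed (use \<alpha> rev in \<open>auto simp: c_def\<close>)
  \<comment> \<open>Around a periodic orbit \<open>u\<close> cancels, so the cost measures by how
    much the orbit fails to maximize.\<close>
  have telescope: "(\<Sum>j<m. c (b j) (tail b (Suc j))) = m * Q - (\<Sum>j<m. \<phi> (tail b j))" if "periodic b m" for b m
  proof -
    have "c (b j) (tail b (Suc j)) = (u (tail b (Suc j)) - u (tail b j)) + (Q - \<phi> (tail b j))" for j
      using tail_rec[of b j, OF periodic_ge_1[OF that]] by (simp add: c_def)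
    then have "(\<Sum>j<m. c (b j) (tail b (Suc j))) = (u (tail b m) - u (tail b 0)) + (\<Sum>j<m. Q - \<phi> (tail b j))"
      using sum_lessThan_telescope[of "\<lambda>j. u (tail b j)" m] by (simp add: sum.distrib)
    then show ?thesis using periodic_tail[OF that, of 0] by (simp add: sum_subtractf)
  qed
  obtain N where N: "\<And>i. a0 i \<le> N"
    using a0(1) unfolding finite_nat_set_iff_bounded_le by blast
  define \<Lambda> where "\<Lambda> = 2 * (real N + 1)\<^sup>2"
  have \<Lambda>: "0 < \<Lambda>"
  proof -
    have "0 < real N + 1" by simp
    then show ?thesis by (simp add: \<Lambda>_def)
  qed
  \<comment> \<open>The perturbation \<open>2 * e * d\<close> has supremum and Hoelder constant at
    most 2 e each, so it moves \<phi> by at most \<epsilon> / 2.\<close>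
  define e where "e = \<epsilon> / 8"
  have e: "0 < e" using \<epsilon> by (simp add: e_def)
  \<comment> \<open>The penalty at distance D / (4 \<Lambda>) is 3 w times
    \<open>D powr \<alpha>\<close>: one share each for the cost of the orbit, the shadowing error
    and the later perturbation.\<close>
  define w where "w = e / 3 * (1 / (4 * \<Lambda>)) powr \<alpha>"
  have w: "0 < w" using e \<Lambda> by (simp add: w_def)
  define X where "X = B * distortion \<alpha>"
  have X: "0 \<le> X" using B_nonneg distortion_pos[OF \<alpha>(1)] by (simp add: X_def)
  define r :: real where "r = (1 / 2) powr \<alpha>"
  have r: "0 < r" "r < 1" using powr_less_mono2[of \<alpha> "1 / 2" 1] \<alpha> by (auto simp: r_def)
  obtain q where q: "X * r ^ q \<le> w"
  proof -
    obtain q where "r ^ q < w / (X + 1)" using real_arch_pow_inv[of "w / (X + 1)" r] w X r by auto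
    then have "(X + 1) * r ^ q < w" using X by (simp add: pos_less_divide_eq mult.commute)
    moreover have "0 < r ^ q" using r by simp
    ultimately have "X * r ^ q \<le> w" unfolding distrib_right by linarith
    then show thesis by (rule that)
  qed
  \<comment> \<open>Isolation with this factor turns (q + 2) times the cost into at most one share
    \<open>w * D powr \<alpha>\<close>.\<close>
  define M where "M = (q + 2) / w"
  have M: "0 < M" using w by (simp add: M_def)
  define D0 where "D0 = 1 / (real N + 2)"
  have D0: "0 < D0" by (simp add: D0_def)
  obtain s where s: "1 + split_const * M \<le> 2 ^ s"
    using real_arch_pow[of 2 "1 + split_const * M"] by (auto intro: less_imp_le)
  define \<tau> where "\<tau> = D0 powr \<alpha> / M"
  have \<tau>: "0 < \<tau>" using D0 M by (simp add: \<tau>_def)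
  obtain b0 n0 where b0: "periodic b0 n0" "range b0 \<subseteq> range a0" "cost b0 n0 * real n0 ^ s < \<tau>"
    by (rule cheap_periodic_exists[OF a0 x0 _ \<tau>, of s]) (use contact in \<open>auto simp: c_def\<close>)
  obtain a n where p: "periodic a n" and ra: "range a \<subseteq> range b0" and cheap: "cost a n < \<tau>"
    and iso: "isolated M a n"
    using isolated_exists[OF less_imp_le[OF M] s b0(1,3)] by blast
  have aN: "a i \<le> N" for i
  proof -
    have "a i \<in> range a0" using ra b0(2) by blast
    then show ?thesis using N by auto
  qed
  have n: "0 < n" using p by (simp add: periodic_def)
  have MD0: "M * cost a n \<le> D0 powr \<alpha>"
    using cheap M by (simp add: \<tau>_def pos_less_divide_eq mult.commute)
  have MA: "0 \<le> M * cost a n" using M cost_nonneg[OF p] by simp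
  have iso': "0 < l \<Longrightarrow> l < n \<Longrightarrow> M * cost a n < \<bar>tail a i - tail a (i + l)\<bar> powr \<alpha>" for i l
    using iso by (simp add: isolated_def)
  obtain D where D: "0 < D" "D \<le> D0" and MD: "M * cost a n \<le> D powr \<alpha>"
    and gap: "\<And>i l. 0 < l \<Longrightarrow> l < n \<Longrightarrow> D \<le> \<bar>tail a i - tail a (i + l)\<bar>"
    using min_gap_exists[OF p D0 MD0 MA iso'] by metis
  define Da where "Da = D powr \<alpha>"
  have Da: "0 < Da" using D by (simp add: Da_def)
  \<comment> \<open>Chosen last, since it depends on the period and the gap: the bound
    \<open>e\<close> controls the Hoelder constant of the perturbation, the other one fits its
    supremum into the third share.\<close>
  define \<rho> where "\<rho> = min e (w * Da / (2 * real n + 2))"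
  have \<rho>: "0 < \<rho>" "\<rho> \<le> e" "(2 * real n + 2) * \<rho> \<le> w * Da"
  proof -
    show "0 < \<rho>" using e w Da by (auto simp: \<rho>_def intro!: divide_pos_pos)
    show "\<rho> \<le> e" by (simp add: \<rho>_def)
    have "\<rho> \<le> w * Da / (2 * real n + 2)" by (simp add: \<rho>_def)
    then show "(2 * real n + 2) * \<rho> \<le> w * Da" by (simp add: pos_le_divide_eq mult.commute)
  qed
  have small: "(q + 2) * cost a n + B * (distortion \<alpha> * ((1 / 2) ^ q * D) powr \<alpha>) + (2 * real n + 2) * \<rho>
      \<le> e * (D / (4 * \<Lambda>)) powr \<alpha>"
  proof -
    have "(q + 2) * cost a n = w * (M * cost a n)" using w by (simp add: M_def)
    also have "\<dots> \<le> w * Da" using MD w by (simp add: Da_def)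
    finally have 1: "(q + 2) * cost a n \<le> w * Da" .
    have "((1 / 2) ^ q * D) powr \<alpha> = r ^ q * Da"
      using D by (simp add: powr_mult r_def Da_def powr_power powr_powr mult.commute flip: powr_realpow)
    then have "B * (distortion \<alpha> * ((1 / 2) ^ q * D) powr \<alpha>) = (X * r ^ q) * Da" by (simp add: X_def)
    also have "\<dots> \<le> w * Da" using q Da by (intro mult_right_mono) auto
    finally have 2: "B * (distortion \<alpha> * ((1 / 2) ^ q * D) powr \<alpha>) \<le> w * Da" .
    have "(D / (4 * \<Lambda>)) powr \<alpha> = Da * (1 / (4 * \<Lambda>)) powr \<alpha>"
    proof -
      have "D / (4 * \<Lambda>) = D * (1 / (4 * \<Lambda>))" by simp
      then show ?thesis unfolding Da_def using powr_mult[of D "1 / (4 * \<Lambda>)" \<alpha>] D \<Lambda> by (simp only:)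
    qed
    then have "e * (D / (4 * \<Lambda>)) powr \<alpha> = w * Da + w * Da + w * Da" by (simp add: w_def field_simps)
    then show ?thesis using 1 2 \<rho>(3) by linarith
  qed
  have inj: "inj_on (tail a) {..<n}"
  proof (rule linorder_inj_onI')
    fix i j assume "i \<in> {..<n}" "j \<in> {..<n}" "i < j"
    moreover from this have "0 < j - i" "j - i < n" by auto
    ultimately show "tail a i \<noteq> tail a j" using gap[of "j - i" i] D(1) by auto
  qed
  define S where "S = tail a ` {..<n}"
  have S: "closed S" "S \<noteq> {}" using n by (auto simp: S_def finite_imp_closed lessThan_empty_iff)
  define d where "d x = infdist x S powr \<alpha>" for x
  have d: "hoelder \<alpha> 1 d" unfolding d_def by (rule hoelder_infdist_powr[OF \<alpha>])
  have d_nonneg: "0 \<le> d x" for x by (simp add: d_def)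
  have d_zero: "d x = 0 \<longleftrightarrow> x \<in> S" for x
    using in_closed_iff_infdist_zero[OF S] by (simp add: d_def)
  have d_le: "\<bar>d x\<bar> \<le> 1" if "x \<in> {0..1}" for x
  proof -
    have "tail a 0 \<in> S" using n by (simp add: S_def)
    then have "infdist x S \<le> \<bar>x - tail a 0\<bar>" using infdist_le by (metis dist_real_def)
    moreover have "tail a 0 \<in> {0..1}" using tail_unit periodic_ge_1[OF p] by blast
    ultimately have "infdist x S \<le> 1" using that by auto
    then show ?thesis using \<alpha> infdist_nonneg[of x S] by (auto simp: d_def intro!: powr_le1)
  qed
  \<comment> \<open>One half of the penalty is consumed by locking, the other remains as the surplus
    that forces uniqueness.\<close>
  define \<psi> where "\<psi> = restrict (\<lambda>x. \<phi> x - 2 * e * d x) {0..1}"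
  have pen: "hoelder \<alpha> (2 * e) (\<lambda>x. 2 * e * d x)" using hoelder_cmult[OF d, of "2 * e"] e by simp
  have neg: "hoelder \<alpha> (2 * e) (\<lambda>x. - (2 * e * d x))" using hoelder_cmult[OF pen, of "- 1"] by simp
  have \<psi>_h: "hoelder \<alpha> (H + 2 * e) \<psi>"
    using hoelder_add[OF H neg] by (simp add: \<psi>_def hoelder_restrict)
  then have \<psi>_space: "\<psi> \<in> holder_space \<alpha>"
    unfolding holder_space_def hoelder_def by (auto simp: \<psi>_def)
  have "holder_norm \<alpha> (\<lambda>x. \<phi> x - \<psi> x) \<le> 2 * e + 2 * e"
  proof (rule holder_norm_le)
    show "\<bar>\<phi> x - \<psi> x\<bar> \<le> 2 * e" if "x \<in> {0..1}" for x
      using d_le[OF that] d_nonneg[of x] e that by (simp add: \<psi>_def abs_mult mult_left_le)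
    show "hoelder \<alpha> (2 * e) (\<lambda>x. \<phi> x - \<psi> x)" using pen by (simp add: hoelder_def \<psi>_def)
  qed
  then have \<psi>_dist: "holder_dist \<alpha> \<phi> \<psi> < \<epsilon>"
    using \<phi>_space \<psi>_space \<epsilon> by (simp add: holder_dist_def e_def)
  have "periodic_optimization \<xi> \<and> \<xi> \<in> essentially_compact \<alpha>"
    if \<xi>: "\<xi> \<in> holder_space \<alpha>" "holder_dist \<alpha> \<psi> \<xi> < \<rho>" for \<xi>
  proof -
    define h where "h x = \<xi> x - \<psi> x" for x
    note hb = holder_dist_bounds[OF \<alpha>(1) \<psi>_space \<xi>(1) less_imp_le[OF \<xi>(2)], folded h_def]
    have h: "hoelder \<alpha> e h"
      unfolding hoelder_def
    proof (intro ballI)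
      fix x y :: real assume "x \<in> {0..1}" "y \<in> {0..1}"
      then have "\<bar>h x - h y\<bar> \<le> \<rho> * \<bar>x - y\<bar> powr \<alpha>" by (rule hoelderD[OF hb(2)])
      also have "\<dots> \<le> e * \<bar>x - y\<bar> powr \<alpha>" using \<rho>(2) by (intro mult_right_mono) auto
      finally show "\<bar>h x - h y\<bar> \<le> e * \<bar>x - y\<bar> powr \<alpha>" .
    qed
    have \<xi>_eq: "\<xi> x = \<phi> x + h x - 2 * e * d x" if "x \<in> {0..1}" for x
      using that by (simp add: h_def \<psi>_def)
    obtain Hx where Hx: "hoelder \<alpha> Hx \<xi>" using holder_spaceD[OF \<xi>(1)] by blast
    \<comment> \<open>Chosen so that \<beta> + Q is the average of \<xi> on the orbit
      \<open>S\<close>.\<close>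
    define \<beta> where "\<beta> = ((\<Sum>i<n. h (tail a i)) - cost a n) / n"
    have \<beta>: "n * \<beta> = (\<Sum>i<n. h (tail a i)) - cost a n" using n by (simp add: \<beta>_def)
    have tu: "tail b j \<in> {0..1}" if "periodic b m" for b m j
      using tail_unit periodic_ge_1[OF that] by blast
    have per: "(\<Sum>j<m. \<xi> (tail b j) + e * d (tail b j)) \<le> m * (\<beta> + Q)" if pb: "periodic b m" for b m
    proof -
      have "(\<Sum>j<m. h (tail b j) - c (b j) (tail b (Suc j)) - e * d (tail b j)) \<le> m * \<beta>"
        unfolding d_def
        by (rule locking[OF p aN D(1) D(2)[unfolded D0_def] gap S_def h hb(1) \<Lambda>_def small \<beta> pb])
      then have "(\<Sum>j<m. h (tail b j)) - (m * Q - (\<Sum>j<m. \<phi> (tail b j))) - (\<Sum>j<m. e * d (tail b j)) \<le> m * \<beta>"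
        unfolding sum_subtractf telescope[OF pb] .
      moreover have "(\<Sum>j<m. \<xi> (tail b j) + e * d (tail b j))
        = (\<Sum>j<m. \<phi> (tail b j)) + (\<Sum>j<m. h (tail b j)) - (\<Sum>j<m. e * d (tail b j))"
      proof -
        have "(\<Sum>j<m. \<xi> (tail b j) + e * d (tail b j)) = (\<Sum>j<m. \<phi> (tail b j) + h (tail b j) - e * d (tail b j))"
          using \<xi>_eq[OF tu[OF pb]] by (intro sum.cong) auto
        then show ?thesis by (simp add: sum.distrib sum_subtractf)
      qed
      ultimately show ?thesis by (simp add: algebra_simps)
    qed
    have orbit_sum: "(\<Sum>i<n. \<xi> (tail a i)) = n * (\<beta> + Q)"
    proof -
      have "d (tail a i) = 0" if "i < n" for i using that d_zero by (simp add: S_def)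
      then have "(\<Sum>i<n. \<xi> (tail a i)) = (\<Sum>i<n. \<phi> (tail a i) + h (tail a i))"
        using \<xi>_eq[OF tu[OF p]] by (intro sum.cong) auto
      moreover have "cost a n = n * Q - (\<Sum>i<n. \<phi> (tail a i))"
        unfolding cost_def by (rule telescope[OF p])
      ultimately show ?thesis using \<beta> by (simp add: sum.distrib algebra_simps)
    qed
    have max: "maximizing \<xi> \<nu> \<longleftrightarrow> \<nu> = per_measure a n" for \<nu>
    proof (rule penalized_maximizing_iff[OF \<alpha>(1) Hx _ _ _ p inj per orbit_sum])
      show "hoelder \<alpha> e (\<lambda>x. e * d x)" using hoelder_cmult[OF d, of e] e by simp
    qed (use e d_nonneg d_zero in \<open>auto simp: S_def\<close>)
    have "periodic_optimization \<xi>"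
      unfolding periodic_optimization_def
      using periodic_orbit_tail[OF p] max per_measure_eq_orbit_measure[OF p inj] by metis
    moreover have "\<xi> \<in> essentially_compact \<alpha>"
      unfolding essentially_compact_def using \<xi>(1) max zero_notin_support_per_measure[OF p] by blast
    ultimately show ?thesis ..
  qed
  then show thesis using that[OF \<psi>_space \<psi>_dist \<rho>(1)] by blast
qed

theorem theorem5:
  fixes \<alpha> :: real
  assumes "0 < \<alpha>" and "\<alpha> \<le> 1"
  shows "\<exists>U. openin (holder_topology \<alpha>) U \<and>
             (\<forall>\<phi>\<in>U. periodic_optimization \<phi>) \<and>
             U \<subseteq> essentially_compact \<alpha> \<and>
             essentially_compact \<alpha> \<subseteq> holder_topology \<alpha> closure_of U"
proof -
  interpret Metric_space "holder_space \<alpha>" "holder_dist \<alpha>"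
    by (rule Metric_space_holder[OF assms(1)])
  have top: "holder_topology \<alpha> = mtopology" by (simp add: holder_topology_def)
  define P where "P = {\<xi>. periodic_optimization \<xi> \<and> \<xi> \<in> essentially_compact \<alpha>}"
  \<comment> \<open>The interior is dense because the perturbation \<psi> comes with a whole ball
    inside \<open>P\<close>.\<close>
  define U where "U = mtopology interior_of P"
  have UP: "U \<subseteq> P" unfolding U_def by (rule interior_of_subset)
  have "essentially_compact \<alpha> \<subseteq> mtopology closure_of U"
  proof
    fix \<phi> assume \<phi>: "\<phi> \<in> essentially_compact \<alpha>"
    then have space: "\<phi> \<in> holder_space \<alpha>" by (simp add: essentially_compact_def)
    have "\<exists>\<psi>\<in>U. \<psi> \<in> mball \<phi> \<epsilon>" if pos: "0 < \<epsilon>" for \<epsilon>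
    proof -
      obtain \<psi> \<rho> where \<psi>: "\<psi> \<in> holder_space \<alpha>" "holder_dist \<alpha> \<phi> \<psi> < \<epsilon>" "0 < \<rho>"
        "\<And>\<xi>. \<xi> \<in> holder_space \<alpha> \<Longrightarrow> holder_dist \<alpha> \<psi> \<xi> < \<rho> \<Longrightarrow>
          periodic_optimization \<xi> \<and> \<xi> \<in> essentially_compact \<alpha>"
        using locked_perturbation_exists[OF assms \<phi> pos] by metis
      have "mball \<psi> \<rho> \<subseteq> P" using \<psi>(4) by (auto simp: P_def)
      then have "\<psi> \<in> U" using \<psi>(1,3) by (auto simp: U_def metric_interior_of)
      then show ?thesis using \<psi>(1,2) space by auto
    qed
    then show "\<phi> \<in> mtopology closure_of U" using space by (auto simp: metric_closure_of)
  qed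
  then show ?thesis
    using UP unfolding top by (intro exI[of _ U]) (auto simp: U_def P_def)
qed

end
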